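(* Let $m\ge1$ and $N\ge2$ be integers, $h=1/N$, and let $\varphi(x)\cong\sum_{\beta=1}^N\stackrel{\circ}{C}([\beta],x)\varphi(h\beta)$ be the lattice optimal interpolation formula in $\widetilde{L_2^{(m)}}(0,1)$ with nodes $h\beta$, $\beta=1,\dots,N$. Integrating the right-hand side over $[0,1]$ yields the rectangular quadrature formula: $$\int_0^1\sum_{\beta=1}^N\stackrel{\circ}{C}([\beta],x)\,\varphi(h\beta)\,dx=h\sum_{\beta=1}^N\varphi(h\beta)$$ for every $\varphi\in\widetilde{L_2^{(m)}}(0,1)$.
   Context: $\widetilde{L_2^{(m)}}(0,1)$ is the Hilbert space of real 1-periodic functions $\varphi$ on $\mathbb{R}$ with locally summable derivatives up to order $m$ and $\int_0^1(\varphi^{(m)}(x))^2dx<\infty$, where functions differing by a constant are identified (in the identity above $\varphi$ denotes any representative), with norm $\|\varphi\|=\left(\int_0^1(\varphi^{(m)}(x))^2dx\right)^{1/2}$. For each $x\in[0,1]$, the lattice optimal coefficients $\stackrel{\circ}{C}([\beta],x)$, $\beta=1,\dots,N$, are the unique real numbers with sum $1$ minimizing the dual norm $\sup_{\|\varphi\|=1}|(\ell,\varphi)|$ of the error functional $(\ell,\varphi)=\varphi(x)-\sum_{\beta=1}^N C([\beta],x)\varphi(h\beta)$. Explicitly, $$\stackrel{\circ}{C}([\beta],x)=h\left(1+\sum_{k\in\mathbb{Z},\ kh\notin\mathbb{Z}}\frac{\exp(2\pi ik(h\beta-x))}{k^{2m}}L(k)\right),\qquad L(k)=\left(\sum_{\gamma\in\mathbb{Z}}\frac{h^{2m}}{|\gamma-hk|^{2m}}\right)^{-1}.$$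 *)

theory Defs
  imports "HOL-Analysis.Analysis"
begin

text \<open>
  A locally summable derivative: \<open>g\<close> is locally summable and \<open>f\<close> is an indefinite Lebesgue
  integral of \<open>g\<close>, i.e. \<open>f\<close> is locally absolutely continuous with \<open>f' = g\<close> almost everywhere
  (equivalently, \<open>f\<close> is the continuous representative of a function with generalized
  derivative \<open>g\<close>; point values of \<open>f\<close> are therefore meaningful).
\<close>

definition summable_deriv :: "(real \<Rightarrow> real) \<Rightarrow> (real \<Rightarrow> real) \<Rightarrow> bool" where
  "summable_deriv f g \<longleftrightarrow>
     (\<forall>a b. a \<le> b \<longrightarrow> set_integrable lborel {a..b} g \<and> f b - f a = (LBINT t:{a..b}. g t))"

primrec nth_summable_deriv :: "nat \<Rightarrow> (real \<Rightarrow> real) \<Rightarrow> (real \<Rightarrow> real) \<Rightarrow> bool" where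
  "nth_summable_deriv 0 f g \<longleftrightarrow> g = f"
| "nth_summable_deriv (Suc k) f g \<longleftrightarrow> (\<exists>f'. summable_deriv f f' \<and> nth_summable_deriv k f' g)"

text \<open>The derivative of order \<open>m \<ge> 1\<close> is determined only up to a null set.\<close>

definition gen_deriv :: "nat \<Rightarrow> (real \<Rightarrow> real) \<Rightarrow> real \<Rightarrow> real" where
  "gen_deriv m f = (SOME g. nth_summable_deriv m f g)"

text \<open>
  Elements of the space are represented by functions; the identification of functions that
  differ by a constant is not made by passing to a quotient type, so \<open>sobolev_norm\<close> is a seminorm
  whose kernel consists of the constants.
\<close>

definition periodic_sobolev :: "nat \<Rightarrow> (real \<Rightarrow> real) set" where
  "periodic_sobolev m =
     {\<phi>. (\<forall>x. \<phi> (x + 1) = \<phi> x) \<and> (\<exists>g. nth_summable_deriv m \<phi> g) \<and>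
         set_integrable lborel {0..1} (\<lambda>x. (gen_deriv m \<phi> x)\<^sup>2)}"

definition sobolev_norm :: "nat \<Rightarrow> (real \<Rightarrow> real) \<Rightarrow> real" where
  "sobolev_norm m \<phi> = sqrt (LBINT x:{0..1}. (gen_deriv m \<phi> x)\<^sup>2)"

definition error_functional :: "nat \<Rightarrow> real \<Rightarrow> (nat \<Rightarrow> real) \<Rightarrow> (real \<Rightarrow> real) \<Rightarrow> real" where
  "error_functional N x c \<phi> = \<phi> x - (\<Sum>\<beta>=1..N. c \<beta> * \<phi> (1 / real N * real \<beta>))"

text \<open>Taken in the extended nonnegative reals, so that no boundedness is presupposed.\<close>

definition error_norm :: "nat \<Rightarrow> nat \<Rightarrow> real \<Rightarrow> (nat \<Rightarrow> real) \<Rightarrow> ennreal" where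
  "error_norm m N x c =
     (SUP \<phi> \<in> {\<phi> \<in> periodic_sobolev m. sobolev_norm m \<phi> = 1}. ennreal \<bar>error_functional N x c \<phi>\<bar>)"

text \<open>
  The sum condition makes the error functional vanish on constants, i.e. well defined modulo
  constants. Extensionality fixes the irrelevant values outside \<open>{1..N}\<close>, so that the
  optimal coefficients can be unique as a function on the naturals.
\<close>

definition admissible_coeffs :: "nat \<Rightarrow> (nat \<Rightarrow> real) set" where
  "admissible_coeffs N = {c \<in> extensional {1..N}. (\<Sum>\<beta>=1..N. c \<beta>) = 1}"

definition opt_coeff :: "nat \<Rightarrow> nat \<Rightarrow> nat \<Rightarrow> real \<Rightarrow> real" where
  "opt_coeff m N \<beta> x =
     (THE c. c \<in> admissible_coeffs N \<and>
             (\<forall>c' \<in> admissible_coeffs N. error_norm m N x c \<le> error_norm m N x c')) \<beta>"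

end

theory Submission imports Defs begin

text \<open>
  The coefficients are never computed. An admissible formula for the point \<open>x\<close>, translated
  cyclically by one node, is admissible for \<open>x + h\<close> with the same error norm, so uniqueness of the
  minimiser gives \<open>C([\<beta> + 1], x + h) = C([\<beta>], x)\<close>. As the coefficients are continuous and
  1-periodic in \<open>x\<close>, all their integrals over a period agree; as they sum to 1, each integral is
  \<open>h\<close>. Existence, uniqueness and continuity of the minimiser come from the parallelogram law for
  the dual norm, together with trigonometric polynomials separating the nodes.
\<close>

text \<open>The norm enters through \<open>gen_deriv\<close>, an arbitrary choice of derivative, so
  it can be handled only once derivatives of order m are known to be unique almost everywhere;
  periodicity of the last derivative also holds only almost everywhere. Norm and point values are
  linked by the bound sqrt |x - y| * norm on |phi x - phi y| for |x - y| <= 1, with the same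
  constant for every m: it makes the error functional bounded and lets it vary continuously with x
  in the dual norm. All facts about the minimiser flow from one estimate,
  \<open>coeff_diff_le\<close>: at each node, the squared gap between two admissible coefficients is
  controlled, uniformly in x, by the excesses of their squared error norms over the squared minimum.
  Zero excess gives uniqueness, vanishing excess makes minimising sequences Cauchy, and the small
  excess at x of the minimiser for a nearby y gives continuity. The parallelogram law controls only
  functionals; a test function isolating one node turns this into control of a coefficient.\<close>

section \<open>Locally summable functions and the vanishing of their integrals\<close>

lemma set_integrable_shift:
  fixes g :: "real \<Rightarrow> real"
  assumes "set_integrable lborel {a + s..b + s} g"
  shows "set_integrable lborel {a..b} (\<lambda>x. g (x + s))"
    and "(LBINT x:{a..b}. g (x + s)) = (LBINT x:{a + s..b + s}. g x)"
proof -
  have eq: "(\<lambda>x. indicator {a + s..b + s} (s + 1 * x) *\<^sub>R g (s + 1 * x)) =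
      (\<lambda>x. indicator {a..b} x *\<^sub>R g (x + s))"
    by (auto simp: fun_eq_iff indicator_def add.commute)
  show "set_integrable lborel {a..b} (\<lambda>x. g (x + s))"
    using lborel_integrable_real_affine[of "\<lambda>x. indicator {a + s..b + s} x *\<^sub>R g x" 1 s] assms
    unfolding set_integrable_def eq by simp
  show "(LBINT x:{a..b}. g (x + s)) = (LBINT x:{a + s..b + s}. g x)"
    using lborel_integral_real_affine[of 1 "\<lambda>x. indicator {a + s..b + s} x *\<^sub>R g x" s]
    unfolding set_lebesgue_integral_def eq by simp
qed

lemma set_integral_Icc_split:
  fixes g :: "real \<Rightarrow> real"
  assumes "set_integrable lborel {a..c} g" "a \<le> b" "b \<le> c"
  shows "(LBINT x:{a..c}. g x) = (LBINT x:{a..b}. g x) + (LBINT x:{b..c}. g x)"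
proof -
  have "{a..c} = {a..b} \<union> {b..c}" using assms by auto
  moreover have "AE x in lborel. \<not> (x \<in> {a..b} \<and> x \<in> {b..c})"
    using AE_lborel_singleton[of b] by eventually_elim auto
  ultimately show ?thesis
    using assms by (simp only:) (intro set_integral_Un_AE set_integrable_subset[OF assms(1)]; auto)
qed

lemma borel_measurable_locally_summable:
  fixes g :: "real \<Rightarrow> real"
  assumes "\<And>a b. a \<le> b \<Longrightarrow> set_integrable lborel {a..b} g"
  shows "g \<in> borel_measurable lborel"
proof (rule borel_measurable_LIMSEQ_real)
  fix n :: nat
  show "(\<lambda>x. indicator {- real n..real n} x *\<^sub>R g x) \<in> borel_measurable lborel"
    using assms[of "- real n" "real n"] unfolding set_integrable_def by simp
next
  fix x :: real
  obtain n :: nat where n: "\<bar>x\<bar> \<le> real n" using real_arch_simple by blast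
  have "\<forall>\<^sub>F k in sequentially. indicator {- real k..real k} x *\<^sub>R g x = g x"
    using eventually_ge_at_top[of n] by eventually_elim (use n in \<open>auto simp: indicator_def\<close>)
  thus "(\<lambda>k. indicator {- real k..real k} x *\<^sub>R g x) \<longlonglongrightarrow> g x"
    by (rule tendsto_eventually)
qed

text \<open>The positive and negative parts of G are densities of two finite measures. By hypothesis
  these agree on all open half-lines, which determine a finite measure, so the densities agree
  almost everywhere; the two parts of a number are equal only if it is 0.\<close>

lemma integrable_eq_0_AE_greaterThan:
  fixes G :: "real \<Rightarrow> real"
  assumes int: "integrable lborel G" and zero: "\<And>x. (LBINT t:{x<..}. G t) = 0"
  shows "AE x in lborel. G x = 0"
proof -
  have [measurable]: "G \<in> borel_measurable lborel" using int by simp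
  have pos: "integrable lborel (\<lambda>t. indicator {x<..} t * max 0 (G t))"
    and neg: "integrable lborel (\<lambda>t. indicator {x<..} t * max 0 (- G t))" for x
    using integrable_mult_indicator[of "{x<..}" lborel "\<lambda>t. max 0 (G t)"]
      integrable_mult_indicator[of "{x<..}" lborel "\<lambda>t. max 0 (- G t)"] int
    by simp_all
  have em: "emeasure (density lborel (\<lambda>t. ennreal (max 0 (F t)))) {x<..}
      = ennreal (LBINT t. indicator {x<..} t * max 0 (F t))"
    if "F \<in> borel_measurable lborel" "integrable lborel (\<lambda>t. indicator {x<..} t * max 0 (F t))"
    for x and F :: "real \<Rightarrow> real"
  proof -
    have "emeasure (density lborel (\<lambda>t. ennreal (max 0 (F t)))) {x<..}
        = (\<integral>\<^sup>+t. ennreal (indicator {x<..} t * max 0 (F t)) \<partial>lborel)"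
      using that(1) by (subst emeasure_density) (auto intro!: nn_integral_cong simp: indicator_def)
    thus ?thesis using that by (simp add: nn_integral_eq_integral)
  qed
  have "(LBINT t. indicator {x<..} t * max 0 (G t)) - (LBINT t. indicator {x<..} t * max 0 (- G t)) = 0" for x
  proof -
    have "(LBINT t. indicator {x<..} t * max 0 (G t)) - (LBINT t. indicator {x<..} t * max 0 (- G t))
       = (LBINT t. indicator {x<..} t * max 0 (G t) - indicator {x<..} t * max 0 (- G t))"
      using pos neg by simp
    also have "\<dots> = (LBINT t:{x<..}. G t)"
      unfolding set_lebesgue_integral_def
      by (intro Bochner_Integration.integral_cong) (auto simp: indicator_def max_def)
    finally show ?thesis using zero by simp
  qed
  hence "density lborel (\<lambda>t. ennreal (max 0 (G t))) = density lborel (\<lambda>t. ennreal (max 0 (- G t)))"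
    by (intro measure_eqI_lessThan) (auto simp: em pos neg)
  hence "AE t in lborel. ennreal (max 0 (G t)) = ennreal (max 0 (- G t))"
    by (subst sigma_finite_measure.density_unique_iff[OF sigma_finite_lborel, symmetric]) auto
  thus ?thesis by eventually_elim (auto simp: max_def split: if_splits)
qed

lemma locally_summable_eq_0_AE:
  fixes g :: "real \<Rightarrow> real"
  assumes int: "\<And>a b. a \<le> b \<Longrightarrow> set_integrable lborel {a..b} g"
    and zero: "\<And>a b. a \<le> b \<Longrightarrow> (LBINT t:{a..b}. g t) = 0"
  shows "AE x in lborel. g x = 0"
proof -
  have [measurable]: "g \<in> borel_measurable lborel"
    using int by (rule borel_measurable_locally_summable)
  have "AE x in lborel. indicator {- real n..real n} x * g x = 0" for n :: nat
  proof (rule integrable_eq_0_AE_greaterThan)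
    show "integrable lborel (\<lambda>x. indicator {- real n..real n} x * g x)"
      using int[of "- real n" "real n"] unfolding set_integrable_def by simp
    fix x
    \<comment> \<open>The truncation of g lives on [-n, n], so the half-line above x reduces to
      [y, n], up to the null set {x}; for y > n the interval is empty.\<close>
    define y where "y = max x (- real n)"
    have "(LBINT t:{x<..}. indicator {- real n..real n} t * g t) = (LBINT t:{y..real n}. g t)"
      unfolding set_lebesgue_integral_def
    proof (rule integral_cong_AE)
      show "AE t in lborel. indicat_real {x<..} t *\<^sub>R (indicat_real {- real n..real n} t * g t) =
          indicat_real {y..real n} t *\<^sub>R g t"
        using AE_lborel_singleton[of x]
        by eventually_elim (auto simp: y_def indicator_def max_def)
    qed simp_all
    also have "\<dots> = 0"
    proof (cases "y \<le> real n")
      case False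
      thus ?thesis by (simp add: set_lebesgue_integral_def)
    qed (rule zero)
    finally show "(LBINT t:{x<..}. indicator {- real n..real n} t * g t) = 0" .
  qed
  hence "AE x in lborel. \<forall>n::nat. indicator {- real n..real n} x * g x = 0"
    by (subst AE_all_countable) blast
  thus ?thesis
  proof eventually_elim
    case (elim x)
    obtain n :: nat where "\<bar>x\<bar> \<le> real n" using real_arch_simple by blast
    with elim[rule_format, of n] show ?case by (auto simp: indicator_def split: if_splits)
  qed
qed

section \<open>Generalized derivatives: continuity, uniqueness, linearity, translation\<close>

lemma summable_derivD:
  assumes "summable_deriv f g" "a \<le> b"
  shows "set_integrable lborel {a..b} g" and "f b - f a = (LBINT t:{a..b}. g t)"
  using assms by (auto simp: summable_deriv_def)

lemma summable_deriv_measurable: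
  "summable_deriv f g \<Longrightarrow> g \<in> borel_measurable lborel"
  by (rule borel_measurable_locally_summable) (rule summable_derivD)

lemma summable_deriv_AE_unique:
  assumes "summable_deriv f g" "summable_deriv f g'"
  shows "AE x in lborel. g x = g' x"
proof -
  have "AE x in lborel. g x - g' x = 0"
  proof (rule locally_summable_eq_0_AE)
    fix a b :: real assume ab: "a \<le> b"
    note * = summable_derivD[OF assms(1) ab] summable_derivD[OF assms(2) ab]
    show "set_integrable lborel {a..b} (\<lambda>x. g x - g' x)" using * by auto
    show "(LBINT t:{a..b}. g t - g' t) = 0" using * by (simp add: set_integral_diff(2))
  qed
  thus ?thesis by simp
qed

lemma summable_deriv_eq_integral:
  assumes "summable_deriv f g" "a \<le> x"
  shows "f x = f a + integral {a..x} g"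
  using summable_derivD[OF assms] set_borel_integral_eq_integral[of "{a..x}" g] by simp

lemma summable_deriv_isCont:
  assumes "summable_deriv f g"
  shows "isCont f x"
proof -
  have "g integrable_on {x - 1..x + 1}"
    by (rule set_borel_integral_eq_integral, rule summable_derivD[OF assms]) simp
  hence "continuous_on {x - 1..x + 1} (\<lambda>y. f (x - 1) + integral {x - 1..y} g)"
    by (intro continuous_intros indefinite_integral_continuous_1)
  hence "continuous_on {x - 1..x + 1} f"
    by (rule continuous_on_eq) (auto simp: summable_deriv_eq_integral[OF assms])
  thus ?thesis
    by (rule continuous_on_interior) (auto simp: interior_atLeastAtMost_real)
qed

lemma summable_deriv_DERIV:
  assumes "summable_deriv f g" "\<And>x. isCont g x"
  shows "(f has_real_derivative g x) (at x)"
proof -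
  have "((\<lambda>y. integral {x - 1..y} g) has_real_derivative g x) (at x within {x - 1..x + 1})"
    using assms(2) by (intro integral_has_real_derivative) (auto intro: continuous_at_imp_continuous_on)
  hence "((\<lambda>y. f (x - 1) + integral {x - 1..y} g) has_real_derivative g x) (at x within {x - 1..x + 1})"
    by (auto intro!: derivative_eq_intros)
  hence "(f has_real_derivative g x) (at x within {x - 1..x + 1})"
    by (rule has_field_derivative_transform_within[OF _ zero_less_one])
      (auto simp: summable_deriv_eq_integral[OF assms(1)])
  thus ?thesis
    by (subst (asm) at_within_interior) (auto simp: interior_atLeastAtMost_real)
qed

text \<open>Intermediate derivatives are hidden behind an existential quantifier in
  \<open>nth_summable_deriv\<close>. Being continuous, they are classical derivatives and hence
  determined at every point, not just almost everywhere.\<close>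

lemma summable_deriv_continuous_unique:
  assumes "summable_deriv f g" "\<And>x. isCont g x" "summable_deriv f g'" "\<And>x. isCont g' x"
  shows "g = g'"
  using DERIV_unique[OF summable_deriv_DERIV[OF assms(1,2)] summable_deriv_DERIV[OF assms(3,4)]]
  by auto

lemma summable_derivI_DERIV:
  assumes "\<And>x. (f has_real_derivative g x) (at x)" "\<And>x. isCont g x"
  shows "summable_deriv f g"
  unfolding summable_deriv_def
proof (intro allI impI conjI)
  fix a b :: real assume ab: "a \<le> b"
  have cont: "continuous_on {a..b} g" using assms(2) by (intro continuous_at_imp_continuous_on) auto
  thus "set_integrable lborel {a..b} g" by (rule borel_integrable_atLeastAtMost')
  show "f b - f a = (LBINT t:{a..b}. g t)"
    unfolding set_lebesgue_integral_def
    by (rule integral_FTC_atLeastAtMost[OF ab _ cont, symmetric])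
      (use assms(1) in \<open>auto simp: has_real_derivative_iff_has_vector_derivative
         intro: has_vector_derivative_at_within\<close>)
qed

lemma summable_deriv_add:
  "summable_deriv f g \<Longrightarrow> summable_deriv f' g' \<Longrightarrow>
    summable_deriv (\<lambda>x. a * f x + b * f' x) (\<lambda>x. a * g x + b * g' x)"
  unfolding summable_deriv_def by (auto simp: algebra_simps)

lemma summable_deriv_shift:
  "summable_deriv f g \<Longrightarrow> summable_deriv (\<lambda>x. f (x + s)) (\<lambda>x. g (x + s))"
  unfolding summable_deriv_def by (auto simp: set_integrable_shift)

lemma nth_summable_deriv_add:
  "nth_summable_deriv m f g \<Longrightarrow> nth_summable_deriv m f' g' \<Longrightarrow>
    nth_summable_deriv m (\<lambda>x. a * f x + b * f' x) (\<lambda>x. a * g x + b * g' x)"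
  by (induction m arbitrary: f f') (auto, metis summable_deriv_add)

lemma nth_summable_deriv_shift:
  "nth_summable_deriv m f g \<Longrightarrow> nth_summable_deriv m (\<lambda>x. f (x + s)) (\<lambda>x. g (x + s))"
  by (induction m arbitrary: f) (auto, metis summable_deriv_shift)

lemma nth_summable_deriv_isCont:
  "nth_summable_deriv (Suc k) f g \<Longrightarrow> isCont f x"
  by (auto intro: summable_deriv_isCont)

text \<open>All derivatives below the top order are themselves indefinite integrals, hence
  continuous and equal pointwise. The induction can therefore peel them off one at a time, and a
  null set appears only at the last differentiation.\<close>

lemma nth_summable_deriv_AE_unique:
  "nth_summable_deriv (Suc k) f g \<Longrightarrow> nth_summable_deriv (Suc k) f g' \<Longrightarrow>
    AE x in lborel. g x = g' x"
proof (induction k arbitrary: f)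
  case 0
  thus ?case by (auto intro: summable_deriv_AE_unique)
next
  case (Suc k)
  from Suc.prems obtain f1 f2 where *: "summable_deriv f f1" "nth_summable_deriv (Suc k) f1 g"
     "summable_deriv f f2" "nth_summable_deriv (Suc k) f2 g'"
    unfolding nth_summable_deriv.simps(2)[of "Suc k"] by blast
  have "f1 = f2"
    using * summable_deriv_continuous_unique nth_summable_deriv_isCont by metis
  with Suc.IH * show ?case by blast
qed

lemma nth_summable_deriv_measurable:
  "nth_summable_deriv (Suc k) f g \<Longrightarrow> g \<in> borel_measurable lborel"
  by (induction k arbitrary: f) (auto dest: summable_deriv_measurable)

section \<open>Periodicity and the modulus of continuity\<close>

lemma nth_summable_deriv_AE_periodic:
  assumes "nth_summable_deriv (Suc k) f g" "\<And>x. f (x + 1) = f x"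
  shows "AE x in lborel. g (x + 1) = g x"
  using nth_summable_deriv_AE_unique[OF nth_summable_deriv_shift[OF assms(1), of 1]] assms by simp

text \<open>The interval [s, s + 1] is cut at 1 and its right piece moved back by one period onto
  [0, s]. Periodicity is assumed only almost everywhere because the top derivative satisfies no
  more.\<close>

lemma set_integral_periodic:
  fixes G :: "real \<Rightarrow> real"
  assumes [measurable]: "G \<in> borel_measurable lborel" and per: "AE x in lborel. G (x + 1) = G x"
    and int: "set_integrable lborel {0..1} G" and s: "0 \<le> s" "s \<le> 1"
  shows "set_integrable lborel {s..s + 1} G"
    and "(LBINT x:{s..s + 1}. G x) = (LBINT x:{0..1}. G x)"
proof -
  have [measurable]: "(\<lambda>x. G (x + - 1)) \<in> borel_measurable lborel"
    by (rule measurable_compose[of "\<lambda>x. x + - 1" lborel lborel]) auto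
  have per': "AE x in lborel. G (x + - 1) = G x"
  proof -
    have "AE x in lborel. G ((- 1 + 1 * x) + 1) = G (- 1 + 1 * x)"
      using per by (intro AE_borel_affine) auto
    thus ?thesis by eventually_elim simp
  qed
  have a: "set_integrable lborel {0..s} G" "set_integrable lborel {s..1} G"
    using s by (auto intro: set_integrable_subset[OF int])
  have b: "set_integrable lborel {1..s + 1} (\<lambda>x. G (x + - 1))"
    "(LBINT x:{1..s + 1}. G (x + - 1)) = (LBINT x:{0..s}. G x)"
    using set_integrable_shift[of 1 "- 1" "s + 1" G] a by simp_all
  have c: "set_integrable lborel {1..s + 1} G"
    using b(1) per' by (subst set_integrable_cong_AE[where g = "\<lambda>x. G (x + - 1)"]) auto
  have d: "(LBINT x:{1..s + 1}. G x) = (LBINT x:{0..s}. G x)"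
    unfolding b(2)[symmetric] using per' by (intro set_lebesgue_integral_cong_AE) auto
  have "{s..s + 1} = {s..1} \<union> {1..s + 1}" using s by auto
  with set_integrable_Un[OF a(2) c] show e: "set_integrable lborel {s..s + 1} G" by simp
  show "(LBINT x:{s..s + 1}. G x) = (LBINT x:{0..1}. G x)"
    using set_integral_Icc_split[OF e, of 1] set_integral_Icc_split[OF int, of s] s d by simp
qed

lemma Cauchy_Schwarz_set_integral:
  fixes g :: "real \<Rightarrow> real"
  assumes ab: "a \<le> b" and g: "set_integrable lborel {a..b} g"
    and g2: "set_integrable lborel {a..b} (\<lambda>x. (g x)\<^sup>2)"
  shows "\<bar>LBINT x:{a..b}. g x\<bar> \<le> sqrt (b - a) * sqrt (LBINT x:{a..b}. (g x)\<^sup>2)"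
proof (cases "a = b")
  case True
  have "(LBINT x:{a..b}. g x) = (LBINT x:{}. g x)"
    by (rule set_integral_cong_set)
      (use AE_lborel_singleton[of a] g in \<open>auto simp: True set_borel_measurable_def set_integrable_def\<close>)
  thus ?thesis using True by (simp add: set_lebesgue_integral_def)
next
  case False
  define I Q where "I = (LBINT x:{a..b}. g x)" and "Q = (LBINT x:{a..b}. (g x)\<^sup>2)"
  have const: "set_integrable lborel {a..b} (\<lambda>x. I\<^sup>2)"
    unfolding set_integrable_def by (intro borel_integrable_compact) auto
  \<comment> \<open>The integrand is the squared deviation of g from its mean I / (b - a), scaled by
    (b - a)^2 to avoid division; nonnegativity of the variance is the Cauchy-Schwarz inequality
    against the constant 1.\<close>
  have "0 \<le> (LBINT x:{a..b}. (I - (b - a) * g x)\<^sup>2)"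
    unfolding set_lebesgue_integral_def by (intro integral_nonneg_AE) auto
  also have "\<dots> = (LBINT x:{a..b}. (I\<^sup>2 - 2 * (b - a) * I * g x) + (b - a)\<^sup>2 * (g x)\<^sup>2)"
    by (simp add: power2_eq_square algebra_simps)
  also have "\<dots> = (b - a) * I\<^sup>2 - 2 * (b - a) * I * I + (b - a)\<^sup>2 * Q"
    using g g2 const ab unfolding I_def Q_def
    by (subst set_integral_add(2), simp, simp, subst set_integral_diff(2), simp, simp)
       (simp add: set_integral_const)
  also have "\<dots> = (b - a) * ((b - a) * Q - I\<^sup>2)"
    by (simp add: power2_eq_square algebra_simps)
  finally have "I\<^sup>2 \<le> (b - a) * Q"
    using ab False by (simp add: zero_le_mult_iff)
  hence "\<bar>I\<bar> \<le> sqrt ((b - a) * Q)" by (simp add: real_le_rsqrt)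
  thus ?thesis unfolding I_def Q_def by (simp add: real_sqrt_mult)
qed

lemma periodic_add_int:
  fixes f :: "real \<Rightarrow> 'a"
  assumes "\<And>x. f (x + 1) = f x"
  shows "f (x + of_int n) = f x"
proof (induction n rule: int_induct[where k = 0])
  case (step1 i)
  thus ?case using assms[of "x + of_int i"] by (simp add: add.assoc)
next
  case (step2 i)
  thus ?case using assms[of "x + of_int (i - 1)"] by (simp add: algebra_simps)
qed simp

text \<open>For order one this is Cauchy-Schwarz on an interval within one period. For higher order,
  let S be the L2 norm of g: by induction f' oscillates by at most S over one period, and
  periodicity of f forces a zero of f' there, so |f'| <= S. Then f is S-Lipschitz, which beats the
  square root bound at distances up to 1 and keeps the constant free of the order.\<close>

lemma nth_summable_deriv_modulus:
  assumes "nth_summable_deriv (Suc k) f g" "\<And>x. f (x + 1) = f x"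
    and "set_integrable lborel {0..1} (\<lambda>x. (g x)\<^sup>2)" "\<bar>x - y\<bar> \<le> 1"
  shows "\<bar>f x - f y\<bar> \<le> sqrt \<bar>x - y\<bar> * sqrt (LBINT x:{0..1}. (g x)\<^sup>2)"
  using assms
proof (induction k arbitrary: f x y)
  case 0
  hence fg: "summable_deriv f g" by simp
  have [measurable]: "g \<in> borel_measurable lborel" using fg by (rule summable_deriv_measurable)
  have per: "AE x in lborel. (g (x + 1))\<^sup>2 = (g x)\<^sup>2"
    using nth_summable_deriv_AE_periodic[OF 0(1,2)] by eventually_elim simp
  have *: "\<bar>f v - f u\<bar> \<le> sqrt (v - u) * sqrt (LBINT x:{0..1}. (g x)\<^sup>2)"
    if uv: "u \<le> v" "v \<le> u + 1" and u: "0 \<le> u" "u \<le> 1" for u v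
  proof -
    have int: "set_integrable lborel {u..u + 1} (\<lambda>x. (g x)\<^sup>2)"
      and eq: "(LBINT x:{u..u + 1}. (g x)\<^sup>2) = (LBINT x:{0..1}. (g x)\<^sup>2)"
      using set_integral_periodic[of "\<lambda>x. (g x)\<^sup>2" u] per 0(3) u by auto
    have int': "set_integrable lborel {u..v} (\<lambda>x. (g x)\<^sup>2)"
      using uv by (auto intro: set_integrable_subset[OF int])
    have "(LBINT x:{u..v}. (g x)\<^sup>2) \<le> (LBINT x:{0..1}. (g x)\<^sup>2)"
      unfolding eq[symmetric] unfolding set_lebesgue_integral_def
      by (rule integral_mono) (use int int' uv in \<open>auto simp: set_integrable_def indicator_def\<close>)
    moreover have "\<bar>f v - f u\<bar> \<le> sqrt (v - u) * sqrt (LBINT x:{u..v}. (g x)\<^sup>2)"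
      using Cauchy_Schwarz_set_integral[OF uv(1) _ int'] summable_derivD[OF fg uv(1)] by simp
    ultimately show ?thesis
      using uv by (meson mult_left_mono order_trans real_sqrt_ge_zero real_sqrt_le_mono diff_ge_0_iff_ge)
  qed
  have **: "\<bar>f v - f u\<bar> \<le> sqrt (v - u) * sqrt (LBINT x:{0..1}. (g x)\<^sup>2)"
    if uv: "u \<le> v" "v \<le> u + 1" for u v
  proof -
    \<comment> \<open>\<open>*\<close> covers only base points in [0, 1]; translating by this
      integer brings u there without changing values of f.\<close>
    define n where "n = - \<lfloor>u\<rfloor>"
    have "0 \<le> u + of_int n" "u + of_int n \<le> 1" unfolding n_def by linarith+
    from *[OF _ _ this, of "v + of_int n"] uv show ?thesis
      using periodic_add_int[of f, OF 0(2)] by simp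
  qed
  show ?case
    using **[of x y] **[of y x] 0(4) by (cases "x \<le> y") (auto simp: abs_minus_commute)
next
  case (Suc k)
  from Suc.prems(1) obtain f' where ff': "summable_deriv f f'" and f'g: "nth_summable_deriv (Suc k) f' g"
    unfolding nth_summable_deriv.simps(2)[of "Suc k"] by blast
  define S where "S = sqrt (LBINT x:{0..1}. (g x)\<^sup>2)"
  have S: "S \<ge> 0" unfolding S_def set_lebesgue_integral_def by (auto intro: integral_nonneg_AE)
  have cont: "isCont f' t" for t using f'g by (rule nth_summable_deriv_isCont)
  have per: "f' (t + 1) = f' t" for t
  proof -
    have cont': "isCont (\<lambda>x. f' (x + 1)) x" for x
      by (rule isCont_o2[OF _ cont]) (intro continuous_intros)
    \<comment> \<open>The translate of f' is a second continuous derivative of the same periodic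
      function f, hence equal to f'.\<close>
    have "summable_deriv f (\<lambda>x. f' (x + 1))"
      using summable_deriv_shift[OF ff', of 1] Suc.prems(2) by simp
    hence "(\<lambda>x. f' (x + 1)) = f'"
      by (rule summable_deriv_continuous_unique[OF _ cont' ff' cont])
    thus ?thesis by metis
  qed
  have near: "\<bar>f' s - f' t\<bar> \<le> S" if "\<bar>s - t\<bar> \<le> 1" for s t
  proof -
    have "\<bar>f' s - f' t\<bar> \<le> sqrt \<bar>s - t\<bar> * S"
      unfolding S_def by (rule Suc.IH[OF f'g per Suc.prems(3) that])
    also have "\<dots> \<le> 1 * S" using that S by (intro mult_right_mono) auto
    finally show ?thesis by simp
  qed
  have deriv: "(f has_real_derivative f' t) (at t)" for t
    by (rule summable_deriv_DERIV[OF ff' cont])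
  have bound: "\<bar>f' t\<bar> \<le> S" for t
  proof -
    obtain z where z: "t < z" "z < t + 1" "f (t + 1) - f t = (t + 1 - t) * f' z"
      using MVT2[of t "t + 1" f f'] deriv by auto
    hence "f' z = 0" using Suc.prems(2) by simp
    thus ?thesis using near[of t z] z by simp
  qed
  have "\<bar>f x - f y\<bar> \<le> \<bar>x - y\<bar> * S"
  proof -
    have "norm (f x - f y) \<le> S * norm (x - y)"
      using bound deriv
      by (intro field_differentiable_bound[of UNIV f f']) (auto simp: has_field_derivative_at_within)
    thus ?thesis by (simp add: mult.commute)
  qed
  also have "\<dots> \<le> sqrt \<bar>x - y\<bar> * S"
  proof -
    have "d \<le> sqrt d" if "0 \<le> d" "d \<le> 1" for d :: real
      using that by (intro real_le_rsqrt) (simp add: power2_eq_square mult_left_le)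
    thus ?thesis using Suc.prems(4) S by (intro mult_right_mono) auto
  qed
  finally show ?case unfolding S_def .
qed

section \<open>The seminormed space: point values, parallelogram law, translation invariance\<close>

lemma periodic_sobolevD:
  assumes "\<phi> \<in> periodic_sobolev m"
  shows "\<phi> (x + 1) = \<phi> x" "nth_summable_deriv m \<phi> (gen_deriv m \<phi>)"
    "set_integrable lborel {0..1} (\<lambda>x. (gen_deriv m \<phi> x)\<^sup>2)"
  using assms someI_ex[of "nth_summable_deriv m \<phi>"] unfolding periodic_sobolev_def gen_deriv_def by auto

lemma sobolev_norm_nonneg: "sobolev_norm m \<phi> \<ge> 0"
  unfolding sobolev_norm_def set_lebesgue_integral_def by (auto intro: integral_nonneg_AE)

lemma sobolev_norm_power2: "(sobolev_norm m \<phi>)\<^sup>2 = (LBINT x:{0..1}. (gen_deriv m \<phi> x)\<^sup>2)"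
  unfolding sobolev_norm_def set_lebesgue_integral_def by (auto intro: integral_nonneg_AE)

text \<open>This removes the choice in \<open>gen_deriv\<close>: the chosen derivative agrees almost
  everywhere with any derivative g at hand, so membership and norm can be read off g.\<close>

lemma periodic_sobolevI:
  assumes m: "0 < m" and per: "\<And>x. \<phi> (x + 1) = \<phi> x" and g: "nth_summable_deriv m \<phi> g"
    and int: "set_integrable lborel {0..1} (\<lambda>x. (g x)\<^sup>2)"
  shows "\<phi> \<in> periodic_sobolev m" and "(sobolev_norm m \<phi>)\<^sup>2 = (LBINT x:{0..1}. (g x)\<^sup>2)"
proof -
  obtain k where k: "m = Suc k" using m gr0_implies_Suc by blast
  have g': "nth_summable_deriv m \<phi> (gen_deriv m \<phi>)"
    unfolding gen_deriv_def using g by (rule someI[of "nth_summable_deriv m \<phi>"])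
  note [measurable] = nth_summable_deriv_measurable[OF g[unfolded k]]
    nth_summable_deriv_measurable[OF g'[unfolded k], folded k]
  have AE: "AE x in lborel. (gen_deriv m \<phi> x)\<^sup>2 = (g x)\<^sup>2"
    using nth_summable_deriv_AE_unique[OF g'[unfolded k] g[unfolded k], folded k]
    by eventually_elim simp
  have "set_integrable lborel {0..1} (\<lambda>x. (gen_deriv m \<phi> x)\<^sup>2)"
    using int AE by (subst set_integrable_cong_AE[where g = "\<lambda>x. (g x)\<^sup>2"]) auto
  thus "\<phi> \<in> periodic_sobolev m" unfolding periodic_sobolev_def using per g by blast
  show "(sobolev_norm m \<phi>)\<^sup>2 = (LBINT x:{0..1}. (g x)\<^sup>2)"
    unfolding sobolev_norm_power2 using AE by (intro set_lebesgue_integral_cong_AE) auto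
qed

lemma periodic_sobolev_modulus:
  assumes m: "0 < m" and \<phi>: "\<phi> \<in> periodic_sobolev m" and "\<bar>x - y\<bar> \<le> 1"
  shows "\<bar>\<phi> x - \<phi> y\<bar> \<le> sqrt \<bar>x - y\<bar> * sobolev_norm m \<phi>"
proof -
  obtain k where k: "m = Suc k" using m gr0_implies_Suc by blast
  show ?thesis unfolding sobolev_norm_def
    using nth_summable_deriv_modulus[of k \<phi> "gen_deriv m \<phi>" x y] periodic_sobolevD[OF \<phi>] assms
    by (simp add: k)
qed

lemma periodic_sobolev_oscillation:
  assumes m: "0 < m" and \<phi>: "\<phi> \<in> periodic_sobolev m"
  shows "\<bar>\<phi> x - \<phi> y\<bar> \<le> sobolev_norm m \<phi>"
proof -
  define r where "r = frac (y - x)"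
  have r: "0 \<le> r" "r \<le> 1" unfolding r_def by (auto simp: frac_lt_1 less_imp_le)
  have "y = (x + r) + of_int \<lfloor>y - x\<rfloor>" unfolding r_def frac_def by simp
  hence "\<phi> y = \<phi> (x + r)"
    using periodic_add_int[of \<phi>, OF periodic_sobolevD(1)[OF \<phi>]] by metis
  hence "\<bar>\<phi> x - \<phi> y\<bar> \<le> sqrt r * sobolev_norm m \<phi>"
    using periodic_sobolev_modulus[OF m \<phi>, of x "x + r"] r by simp
  also have "\<dots> \<le> 1 * sobolev_norm m \<phi>"
    using r by (intro mult_right_mono sobolev_norm_nonneg) auto
  finally show ?thesis by simp
qed

text \<open>The scalars a and b are built in so that one proof serves closure under linear
  combinations, scaling (b = 0) and the combination needed for the dual norm. Square integrability
  follows from 2 p q <= p^2 + q^2.\<close>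

lemma periodic_sobolev_parallelogram:
  assumes m: "0 < m" and \<phi>: "\<phi> \<in> periodic_sobolev m" and \<psi>: "\<psi> \<in> periodic_sobolev m"
  shows "(\<lambda>x. a * \<phi> x + b * \<psi> x) \<in> periodic_sobolev m"
    and "(sobolev_norm m (\<lambda>x. a * \<phi> x + b * \<psi> x))\<^sup>2 + (sobolev_norm m (\<lambda>x. a * \<phi> x + - b * \<psi> x))\<^sup>2
      = 2 * (a * sobolev_norm m \<phi>)\<^sup>2 + 2 * (b * sobolev_norm m \<psi>)\<^sup>2"
proof -
  obtain k where k: "m = Suc k" using m gr0_implies_Suc by blast
  define u v where "u = gen_deriv m \<phi>" and "v = gen_deriv m \<psi>"
  note D = periodic_sobolevD[OF \<phi>, folded u_def] periodic_sobolevD[OF \<psi>, folded v_def]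
  have [measurable]: "u \<in> borel_measurable lborel" "v \<in> borel_measurable lborel"
    using D(2,5) nth_summable_deriv_measurable unfolding k by blast+
  have nth: "nth_summable_deriv m (\<lambda>x. a * \<phi> x + b * \<psi> x) (\<lambda>x. a * u x + b * v x)" for b
    using D by (intro nth_summable_deriv_add)
  have int: "set_integrable lborel {0..1} (\<lambda>x. (a * u x + b * v x)\<^sup>2)" for b
  proof (rule set_integrable_bound)
    show "set_integrable lborel {0..1} (\<lambda>x. 2 * a\<^sup>2 * (u x)\<^sup>2 + 2 * b\<^sup>2 * (v x)\<^sup>2)"
      using D by (intro set_integral_add set_integrable_mult_right) auto
    have "(a * u x + b * v x)\<^sup>2 \<le> 2 * a\<^sup>2 * (u x)\<^sup>2 + 2 * b\<^sup>2 * (v x)\<^sup>2" for x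
      using zero_le_power2[of "a * u x - b * v x"] by (simp add: power2_eq_square algebra_simps)
    thus "AE x in lborel. x \<in> {0..1} \<longrightarrow> norm ((a * u x + b * v x)\<^sup>2)
       \<le> norm (2 * a\<^sup>2 * (u x)\<^sup>2 + 2 * b\<^sup>2 * (v x)\<^sup>2)"
      by (auto simp: abs_of_nonneg)
  qed (auto simp: set_borel_measurable_def)
  have per: "a * \<phi> (x + 1) + b * \<psi> (x + 1) = a * \<phi> x + b * \<psi> x" for b x using D by simp
  note I = periodic_sobolevI[OF m per nth int]
  show "(\<lambda>x. a * \<phi> x + b * \<psi> x) \<in> periodic_sobolev m" by (rule I)
  have "(LBINT x:{0..1}. (a * u x + b * v x)\<^sup>2) + (LBINT x:{0..1}. (a * u x + - b * v x)\<^sup>2)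
     = (LBINT x:{0..1}. (a * u x + b * v x)\<^sup>2 + (a * u x + - b * v x)\<^sup>2)"
    using int by (intro set_integral_add(2)[symmetric])
  also have "\<dots> = (LBINT x:{0..1}. (2 * a\<^sup>2) * (u x)\<^sup>2 + (2 * b\<^sup>2) * (v x)\<^sup>2)"
    by (simp add: power2_eq_square algebra_simps)
  also have "\<dots> = (2 * a\<^sup>2) * (LBINT x:{0..1}. (u x)\<^sup>2) + (2 * b\<^sup>2) * (LBINT x:{0..1}. (v x)\<^sup>2)"
    using D by (subst set_integral_add(2)) auto
  finally show "(sobolev_norm m (\<lambda>x. a * \<phi> x + b * \<psi> x))\<^sup>2
     + (sobolev_norm m (\<lambda>x. a * \<phi> x + - b * \<psi> x))\<^sup>2
      = 2 * (a * sobolev_norm m \<phi>)\<^sup>2 + 2 * (b * sobolev_norm m \<psi>)\<^sup>2"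
    unfolding I(2) by (simp add: power_mult_distrib sobolev_norm_power2 u_def v_def)
qed

lemma periodic_sobolev_scale:
  assumes m: "0 < m" and \<phi>: "\<phi> \<in> periodic_sobolev m"
  shows "(\<lambda>x. a * \<phi> x) \<in> periodic_sobolev m" "sobolev_norm m (\<lambda>x. a * \<phi> x) = \<bar>a\<bar> * sobolev_norm m \<phi>"
proof -
  show "(\<lambda>x. a * \<phi> x) \<in> periodic_sobolev m"
    using periodic_sobolev_parallelogram(1)[OF m \<phi> \<phi>, of a 0] by simp
  have "(sobolev_norm m (\<lambda>x. a * \<phi> x))\<^sup>2 = (\<bar>a\<bar> * sobolev_norm m \<phi>)\<^sup>2"
    using periodic_sobolev_parallelogram(2)[OF m \<phi> \<phi>, of a 0] by (simp add: power_mult_distrib)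
  thus "sobolev_norm m (\<lambda>x. a * \<phi> x) = \<bar>a\<bar> * sobolev_norm m \<phi>"
    by (subst (asm) power2_eq_iff_nonneg) (auto intro: sobolev_norm_nonneg mult_nonneg_nonneg)
qed

lemma periodic_sobolev_shift:
  assumes m: "0 < m" and \<phi>: "\<phi> \<in> periodic_sobolev m" and s: "0 \<le> s" "s \<le> 1"
  shows "(\<lambda>x. \<phi> (x + s)) \<in> periodic_sobolev m" "sobolev_norm m (\<lambda>x. \<phi> (x + s)) = sobolev_norm m \<phi>"
proof -
  obtain k where k: "m = Suc k" using m gr0_implies_Suc by blast
  define u where "u = gen_deriv m \<phi>"
  note D = periodic_sobolevD[OF \<phi>, folded u_def]
  have [measurable]: "u \<in> borel_measurable lborel"
    using D(2) nth_summable_deriv_measurable unfolding k by blast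
  have "AE x in lborel. (u (x + 1))\<^sup>2 = (u x)\<^sup>2"
    using nth_summable_deriv_AE_periodic[OF D(2)[unfolded k] D(1)] by eventually_elim simp
  note P = set_integral_periodic[of "\<lambda>x. (u x)\<^sup>2", OF _ this D(3) s]
  have int: "set_integrable lborel {0..1} (\<lambda>x. (u (x + s))\<^sup>2)"
    "(LBINT x:{0..1}. (u (x + s))\<^sup>2) = (LBINT x:{0..1}. (u x)\<^sup>2)"
    using set_integrable_shift[of 0 s 1 "\<lambda>x. (u x)\<^sup>2"] P by (auto simp: add.commute)
  have per: "\<phi> (x + 1 + s) = \<phi> (x + s)" for x using D(1)[of "x + s"] by (simp add: ac_simps)
  note I = periodic_sobolevI[OF m per nth_summable_deriv_shift[OF D(2)] int(1)]
  show "(\<lambda>x. \<phi> (x + s)) \<in> periodic_sobolev m" by (rule I)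
  show "sobolev_norm m (\<lambda>x. \<phi> (x + s)) = sobolev_norm m \<phi>"
    using I(2) int(2) sobolev_norm_power2[of m \<phi>, folded u_def]
    by (metis power2_eq_iff_nonneg sobolev_norm_nonneg)
qed

section \<open>Trigonometric polynomials that separate the nodes\<close>

lemma nth_summable_deriv_cos:
  "nth_summable_deriv m (\<lambda>x. c * cos (a * x + b)) (\<lambda>x. c * a ^ m * cos (a * x + b + real m * (pi / 2)))"
proof (induction m arbitrary: b c)
  case (Suc m)
  \<comment> \<open>Writing differentiation as a phase advance by pi / 2 keeps the derivative in the
    same family, so the induction hypothesis, general in b and c, applies without alternating sine
    and cosine.\<close>
  have "summable_deriv (\<lambda>x. c * cos (a * x + b)) (\<lambda>x. (c * a) * cos (a * x + (b + pi / 2)))"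
  proof (rule summable_derivI_DERIV)
    fix x
    have "cos (a * x + (b + pi / 2)) = - sin (a * x + b)"
      using cos_add[of "a * x + b" "pi / 2"] by (simp add: add.assoc)
    thus "((\<lambda>x. c * cos (a * x + b)) has_real_derivative (c * a) * cos (a * x + (b + pi / 2))) (at x)"
      by (auto intro!: derivative_eq_intros)
    show "isCont (\<lambda>x. (c * a) * cos (a * x + (b + pi / 2))) x"
      by (intro continuous_intros)
  qed
  moreover have "(\<lambda>x. (c * a) * a ^ m * cos (a * x + (b + pi / 2) + real m * (pi / 2)))
      = (\<lambda>x. c * a ^ Suc m * cos (a * x + b + real (Suc m) * (pi / 2)))"
    by (simp add: add_divide_distrib ring_distribs ac_simps)
  ultimately show ?case using Suc[of "c * a" "b + pi / 2"] by auto
qed simp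

lemma cos_in_periodic_sobolev:
  assumes m: "0 < m"
  shows "(\<lambda>x. cos (2 * pi * real k * (x - b))) \<in> periodic_sobolev m"
proof (rule periodic_sobolevI(1)[OF m])
  define a where "a = 2 * pi * real k"
  show "cos (2 * pi * real k * (x + 1 - b)) = cos (2 * pi * real k * (x - b))" for x
    using cos_add[of "2 * pi * real k * (x - b)" "2 * pi * real k"]
      cos_int_2pin[of "int k"] sin_int_2pin[of "int k"] by (simp add: algebra_simps)
  show "nth_summable_deriv m (\<lambda>x. cos (2 * pi * real k * (x - b)))
     (\<lambda>x. 1 * a ^ m * cos (a * x + - a * b + real m * (pi / 2)))"
    using nth_summable_deriv_cos[of m 1 a "- a * b"] by (simp add: a_def algebra_simps)
  show "set_integrable lborel {0..1} (\<lambda>x. (1 * a ^ m * cos (a * x + - a * b + real m * (pi / 2)))\<^sup>2)"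
    by (intro borel_integrable_atLeastAtMost' continuous_intros)
qed

text \<open>With the constant term k = 0 added, this sum would be N at node beta and 0 at every
  other node. Dropping that term changes it only by a constant, which the seminorm does not
  see.\<close>

definition node_fun :: "nat \<Rightarrow> nat \<Rightarrow> real \<Rightarrow> real" where
  "node_fun N \<beta> x = (\<Sum>k=1..<N. cos (2 * pi * real k * (x - 1 / real N * real \<beta>)))"

lemma node_fun_in_periodic_sobolev:
  assumes m: "0 < m"
  shows "node_fun N \<beta> \<in> periodic_sobolev m"
proof -
  have "(\<lambda>x. \<Sum>k\<in>K. cos (2 * pi * real k * (x - b))) \<in> periodic_sobolev m"
    if "finite K" for K :: "nat set" and b
    using that
  proof induction
    case empty
    show ?case using periodic_sobolev_scale(1)[OF m cos_in_periodic_sobolev[OF m], of 0] by simp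
  next
    case (insert k K)
    thus ?case
      using periodic_sobolev_parallelogram(1)[OF m cos_in_periodic_sobolev[OF m] insert.IH, of 1 k b 1]
      by simp
  qed
  thus ?thesis unfolding node_fun_def[abs_def] by simp
qed

text \<open>The sum is the real part of a full geometric sum of powers of an N-th root of unity z;
  the bound on j, together with j being nonzero, excludes z = 1.\<close>

lemma sum_cos_roots_of_unity:
  assumes N: "0 < N" and j: "j \<noteq> 0" "\<bar>j\<bar> < int N"
  shows "(\<Sum>k<N. cos (2 * pi * real k * (of_int j / real N))) = 0"
proof -
  define z where "z = cis (2 * pi * of_int j / real N)"
  have "z \<noteq> 1"
  proof
    assume "z = 1"
    hence "cos (2 * pi * of_int j / real N) = 1" unfolding z_def by (simp add: complex_eq_iff)
    then obtain i :: int where "2 * pi * of_int j / real N = of_int i * 2 * pi"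
      by (auto simp: cos_one_2pi_int)
    hence "of_int j = of_int i * real N" using N by (simp add: field_simps)
    hence ji: "j = i * int N" by (metis of_int_eq_iff of_int_mult of_int_of_nat_eq)
    with j have "i \<noteq> 0" by auto
    hence "\<bar>j\<bar> \<ge> int N" unfolding ji abs_mult using N by simp
    with j show False by simp
  qed
  moreover have "z ^ N = 1"
  proof -
    have "z ^ N = cis (2 * pi * of_int j)" using N by (simp add: z_def Complex.DeMoivre)
    thus ?thesis using cos_int_2pin[of j] sin_int_2pin[of j] by (simp add: complex_eq_iff mult.commute)
  qed
  ultimately have "(\<Sum>k<N. z ^ k) = 0" by (simp add: geometric_sum)
  moreover have "Re (\<Sum>k<N. z ^ k) = (\<Sum>k<N. cos (2 * pi * real k * (of_int j / real N)))"
    by (simp add: z_def Complex.DeMoivre algebra_simps)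
  ultimately show ?thesis by simp
qed

lemma node_fun_node:
  assumes N: "0 < N" and \<beta>: "\<beta> \<in> {1..N}" "\<gamma> \<in> {1..N}"
  shows "node_fun N \<beta> (1 / real N * real \<gamma>) = (if \<gamma> = \<beta> then real N else 0) - 1"
proof -
  have "{..<N} = insert 0 {1..<N}" using N by auto
  hence "(\<Sum>k<N. cos (2 * pi * real k * (of_int (int \<gamma> - int \<beta>) / real N)))
     = 1 + node_fun N \<beta> (1 / real N * real \<gamma>)"
    by (simp add: node_fun_def diff_divide_distrib)
  moreover have "\<bar>int \<gamma> - int \<beta>\<bar> < int N" using \<beta> by auto
  ultimately show ?thesis using sum_cos_roots_of_unity[OF N, of "int \<gamma> - int \<beta>"] by auto
qed

section \<open>The error functional and cyclic translation of the weights\<close>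

definition err_norm :: "nat \<Rightarrow> nat \<Rightarrow> real \<Rightarrow> (nat \<Rightarrow> real) \<Rightarrow> real" where
  "err_norm m N x c = enn2real (error_norm m N x c)"

definition min_err :: "nat \<Rightarrow> nat \<Rightarrow> real \<Rightarrow> real" where
  "min_err m N x = (INF c \<in> admissible_coeffs N. err_norm m N x c)"

text \<open>The weight of each node moves to the next node. The last weight wraps round to node 1
  because periodicity identifies the node at 1 with 0; the restriction keeps the result
  extensional.\<close>

definition cyclic_shift :: "nat \<Rightarrow> (nat \<Rightarrow> real) \<Rightarrow> nat \<Rightarrow> real" where
  "cyclic_shift N c = (\<lambda>\<beta>\<in>{1..N}. if \<beta> = 1 then c N else c (\<beta> - 1))"

lemma error_functional_linear:
  "error_functional N x c (\<lambda>y. a * \<phi> y + b * \<psi> y)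
    = a * error_functional N x c \<phi> + b * error_functional N x c \<psi>"
  by (simp add: error_functional_def sum_distrib_left sum.distrib algebra_simps)

text \<open>Only differences of point values are controlled by the seminorm; the sum condition is
  what lets the error be expressed through them.\<close>

lemma error_functional_node_diff:
  assumes "(\<Sum>\<beta>=1..N. c \<beta>) = 1"
  shows "error_functional N x c \<phi> = (\<Sum>\<beta>=1..N. c \<beta> * (\<phi> x - \<phi> (1 / real N * real \<beta>)))"
  using assms by (simp add: error_functional_def right_diff_distrib sum_subtractf flip: sum_distrib_right)

lemma sum_cyclic_shift:
  assumes N: "0 < N"
  shows "(\<Sum>\<beta>=1..N. cyclic_shift N c \<beta> * f \<beta>) = (\<Sum>\<beta>=1..<N. c \<beta> * f (\<beta> + 1)) + c N * f 1"
proof -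
  have "{1..N} = insert 1 {1 + 1..<N + 1}" using N by auto
  hence "(\<Sum>\<beta>=1..N. cyclic_shift N c \<beta> * f \<beta>)
      = c N * f 1 + (\<Sum>\<beta>=1 + 1..<N + 1. cyclic_shift N c \<beta> * f \<beta>)"
    using N by (simp add: cyclic_shift_def)
  also have "(\<Sum>\<beta>=1 + 1..<N + 1. cyclic_shift N c \<beta> * f \<beta>)
      = (\<Sum>\<beta>=1..<N. cyclic_shift N c (\<beta> + 1) * f (\<beta> + 1))"
    by (rule sum.shift_bounds_nat_ivl)
  also have "\<dots> = (\<Sum>\<beta>=1..<N. c \<beta> * f (\<beta> + 1))"
    by (intro sum.cong) (auto simp: cyclic_shift_def)
  finally show ?thesis by simp
qed

lemma sum_Icc_last:
  fixes f :: "nat \<Rightarrow> real"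
  assumes "0 < N"
  shows "(\<Sum>\<beta>=1..N. f \<beta>) = (\<Sum>\<beta>=1..<N. f \<beta>) + f N"
proof -
  have "{1..N} = insert N {1..<N}" using assms by auto
  thus ?thesis by simp
qed

lemma cyclic_shift_admissible:
  assumes N: "0 < N" and c: "c \<in> admissible_coeffs N"
  shows "cyclic_shift N c \<in> admissible_coeffs N"
  using sum_cyclic_shift[OF N, of c "\<lambda>_. 1"] c sum_Icc_last[OF N, of c]
  by (auto simp: admissible_coeffs_def) (simp add: cyclic_shift_def)

text \<open>Moving the point and the weights forward by h is dual to translating the function by h.
  The wrapped weight is accounted for by phi (1 + h) = phi h.\<close>

lemma error_functional_cyclic_shift:
  assumes N: "0 < N" and per: "\<And>x. \<phi> (x + 1) = \<phi> x"
  shows "error_functional N (x + 1 / real N) (cyclic_shift N c) \<phi>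
    = error_functional N x c (\<lambda>y. \<phi> (y + 1 / real N))"
proof -
  have "\<phi> (1 / real N * real N + 1 / real N) = \<phi> (1 / real N)"
    using N per[of "1 / real N"] by (simp add: add.commute)
  thus ?thesis
    unfolding error_functional_def sum_cyclic_shift[OF N] sum_Icc_last[OF N]
    by (simp add: add_divide_distrib add.commute)
qed

section \<open>The dual norm, its parallelogram law and the control of coefficients\<close>

context
  fixes m N :: nat
  assumes m: "0 < m" and N: "2 \<le> N"
begin

lemma error_functional_le_sum:
  assumes c: "(\<Sum>\<beta>=1..N. c \<beta>) = 1" and \<phi>: "\<phi> \<in> periodic_sobolev m"
  shows "\<bar>error_functional N x c \<phi>\<bar> \<le> (\<Sum>\<beta>=1..N. \<bar>c \<beta>\<bar>) * sobolev_norm m \<phi>"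
  unfolding error_functional_node_diff[OF c] sum_distrib_right
  by (rule order_trans[OF sum_abs sum_mono])
    (auto simp: abs_mult intro!: mult_left_mono periodic_sobolev_oscillation m \<phi>)

text \<open>The oscillation bound makes the supremum finite, so passing to reals by
  \<open>enn2real\<close>, which would send infinity to 0, loses nothing.\<close>

lemma error_norm_eq:
  assumes c: "(\<Sum>\<beta>=1..N. c \<beta>) = 1"
  shows "error_norm m N x c = ennreal (err_norm m N x c)"
proof -
  have "error_norm m N x c \<le> ennreal (\<Sum>\<beta>=1..N. \<bar>c \<beta>\<bar>)"
    unfolding error_norm_def
  proof (intro SUP_least ennreal_leI)
    fix \<phi> assume "\<phi> \<in> {\<phi> \<in> periodic_sobolev m. sobolev_norm m \<phi> = 1}"
    thus "\<bar>error_functional N x c \<phi>\<bar> \<le> (\<Sum>\<beta>=1..N. \<bar>c \<beta>\<bar>)"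
      using error_functional_le_sum[OF c, of \<phi> x] by simp
  qed
  hence "error_norm m N x c < \<infinity>" using le_less_trans by fastforce
  thus ?thesis by (simp add: err_norm_def)
qed

lemma err_norm_nonneg: "0 \<le> err_norm m N x c"
  by (simp add: err_norm_def)

lemma error_functional_le_err_norm:
  assumes c: "(\<Sum>\<beta>=1..N. c \<beta>) = 1" and \<phi>: "\<phi> \<in> periodic_sobolev m"
  shows "\<bar>error_functional N x c \<phi>\<bar> \<le> err_norm m N x c * sobolev_norm m \<phi>"
proof (cases "sobolev_norm m \<phi> = 0")
  \<comment> \<open>The supremum ranges over functions of norm 1 and says nothing here; the cruder
    bound by the sum of |c beta| shows that the error vanishes.\<close>
  case True
  thus ?thesis using error_functional_le_sum[OF c \<phi>] by simp
next
  case False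
  define s where "s = sobolev_norm m \<phi>"
  have s: "s > 0" using False sobolev_norm_nonneg[of m \<phi>] by (simp add: s_def)
  define \<psi> where "\<psi> = (\<lambda>x. (1 / s) * \<phi> x)"
  have \<psi>: "\<psi> \<in> periodic_sobolev m" "sobolev_norm m \<psi> = 1"
    using periodic_sobolev_scale[OF m \<phi>, of "1 / s"] s by (auto simp: \<psi>_def s_def)
  have "ennreal \<bar>error_functional N x c \<psi>\<bar> \<le> error_norm m N x c"
    unfolding error_norm_def using \<psi> by (intro SUP_upper) auto
  hence "\<bar>error_functional N x c \<psi>\<bar> \<le> err_norm m N x c"
    unfolding error_norm_eq[OF c] using err_norm_nonneg by (simp add: ennreal_le_iff)
  moreover have "error_functional N x c \<psi> = error_functional N x c \<phi> / s"
    using error_functional_linear[of N x c "1 / s" \<phi> 0 \<phi>] by (simp add: \<psi>_def)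
  ultimately show ?thesis using s by (simp add: s_def abs_div_pos divide_le_eq)
qed

lemma err_norm_least:
  assumes M: "0 \<le> M" and c: "(\<Sum>\<beta>=1..N. c \<beta>) = 1"
    and bound: "\<And>\<phi>. \<phi> \<in> periodic_sobolev m \<Longrightarrow> sobolev_norm m \<phi> = 1 \<Longrightarrow>
      \<bar>error_functional N x c \<phi>\<bar> \<le> M"
  shows "err_norm m N x c \<le> M"
proof -
  have "error_norm m N x c \<le> ennreal M"
    unfolding error_norm_def using bound by (intro SUP_least ennreal_leI) auto
  thus ?thesis unfolding error_norm_eq[OF c] using M by (simp add: ennreal_le_iff)
qed

text \<open>
  For unit vectors \<open>u\<close>, \<open>v\<close> put \<open>\<alpha> = (f + g) u\<close> and \<open>\<gamma> = (f - g) v\<close>. Then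
  \<open>\<alpha>\<^sup>2 + \<gamma>\<^sup>2 = f (\<alpha> u + \<gamma> v) + g (\<alpha> u - \<gamma> v)\<close>, so the parallelogram law of the
  space bounds its own dual norm, without any Riesz representation.
\<close>

lemma error_functional_parallelogram:
  fixes x :: real and c c' :: "nat \<Rightarrow> real"
  assumes c: "(\<Sum>\<beta>=1..N. c \<beta>) = 1" "(\<Sum>\<beta>=1..N. c' \<beta>) = 1"
    and u: "u \<in> periodic_sobolev m" "sobolev_norm m u = 1"
    and v: "v \<in> periodic_sobolev m" "sobolev_norm m v = 1"
  shows "(error_functional N x c u + error_functional N x c' u)\<^sup>2
     + (error_functional N x c v - error_functional N x c' v)\<^sup>2
    \<le> 2 * (err_norm m N x c)\<^sup>2 + 2 * (err_norm m N x c')\<^sup>2"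
proof -
  define f g A B where "f = error_functional N x c" and "g = error_functional N x c'"
    and "A = err_norm m N x c" and "B = err_norm m N x c'"
  define \<alpha> \<gamma> where "\<alpha> = f u + g u" and "\<gamma> = f v - g v"
  define w z where "w = (\<lambda>x. \<alpha> * u x + \<gamma> * v x)" and "z = (\<lambda>x. \<alpha> * u x + - \<gamma> * v x)"
  define p q where "p = sobolev_norm m w" and "q = sobolev_norm m z"
  define S where "S = \<alpha>\<^sup>2 + \<gamma>\<^sup>2"
  have wz: "w \<in> periodic_sobolev m" "z \<in> periodic_sobolev m"
    unfolding w_def z_def by (rule periodic_sobolev_parallelogram(1)[OF m u(1) v(1)])+
  have pq: "p\<^sup>2 + q\<^sup>2 = 2 * S"
    using periodic_sobolev_parallelogram(2)[OF m u(1) v(1), of \<alpha> \<gamma>] u v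
    by (simp add: p_def q_def w_def z_def S_def)
  have "S = f w + g z"
    unfolding f_def g_def w_def z_def error_functional_linear
    unfolding f_def[symmetric] g_def[symmetric]
    by (simp add: S_def \<alpha>_def \<gamma>_def power2_eq_square algebra_simps)
  also have "\<dots> \<le> A * p + B * q"
    using error_functional_le_err_norm[OF c(1) wz(1), of x]
      error_functional_le_err_norm[OF c(2) wz(2), of x]
    by (simp add: f_def g_def A_def B_def p_def q_def)
  finally have "S \<le> A * p + B * q" .
  hence "S\<^sup>2 \<le> (A * p + B * q)\<^sup>2" by (intro power_mono) (auto simp: S_def)
  also have "\<dots> \<le> (A\<^sup>2 + B\<^sup>2) * (p\<^sup>2 + q\<^sup>2)"
    using zero_le_power2[of "A * q - B * p"] by (simp add: power2_eq_square algebra_simps)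
  finally have "S * S \<le> (2 * A\<^sup>2 + 2 * B\<^sup>2) * S"
    unfolding pq by (simp add: power2_eq_square algebra_simps)
  moreover have "0 \<le> S" "0 \<le> 2 * A\<^sup>2 + 2 * B\<^sup>2" by (simp_all add: S_def)
  ultimately have "S \<le> 2 * A\<^sup>2 + 2 * B\<^sup>2"
    by (cases "S = 0") (auto simp: mult_le_cancel_right)
  thus ?thesis by (simp add: S_def \<alpha>_def \<gamma>_def f_def g_def A_def B_def)
qed

text \<open>The values at two distinct nodes differ by N, so the oscillation bound forces a norm of
  at least N; N >= 2 supplies the second node.\<close>

lemma node_fun_norm_pos:
  assumes \<beta>: "\<beta> \<in> {1..N}"
  shows "0 < sobolev_norm m (node_fun N \<beta>)"
proof -
  obtain \<gamma> where \<gamma>: "\<gamma> \<in> {1..N}" "\<gamma> \<noteq> \<beta>"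
    using N by (cases "\<beta> = 1") (auto intro: that[of 1] that[of 2])
  have "\<bar>node_fun N \<beta> (1 / real N * real \<beta>) - node_fun N \<beta> (1 / real N * real \<gamma>)\<bar>
      \<le> sobolev_norm m (node_fun N \<beta>)"
    by (intro periodic_sobolev_oscillation m node_fun_in_periodic_sobolev)
  thus ?thesis
    using node_fun_node[OF _ \<beta> \<beta>] node_fun_node[OF _ \<beta> \<gamma>(1)] \<gamma> N by simp
qed

text \<open>The value at x cancels in the difference, and so does the constant -1 in the nodal
  values, because both weight vectors have the same sum. Only the coefficient at beta
  survives.\<close>

lemma error_functional_node_fun_diff:
  assumes c: "(\<Sum>\<beta>=1..N. c \<beta>) = 1" "(\<Sum>\<beta>=1..N. c' \<beta>) = 1" and \<beta>: "\<beta> \<in> {1..N}"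
  shows "error_functional N x c (node_fun N \<beta>) - error_functional N x c' (node_fun N \<beta>)
    = real N * (c' \<beta> - c \<beta>)"
proof -
  have E: "(\<Sum>\<gamma>=1..N. d \<gamma> * node_fun N \<beta> (1 / real N * real \<gamma>)) = real N * d \<beta> - (\<Sum>\<gamma>=1..N. d \<gamma>)"
    for d :: "nat \<Rightarrow> real"
  proof -
    have "(\<Sum>\<gamma>=1..N. d \<gamma> * node_fun N \<beta> (1 / real N * real \<gamma>))
       = (\<Sum>\<gamma>=1..N. (if \<gamma> = \<beta> then real N * d \<beta> else 0) - d \<gamma>)"
      using \<beta> N by (intro sum.cong refl, subst node_fun_node) (auto simp: algebra_simps)
    thus ?thesis using \<beta> by (simp add: sum_subtractf)
  qed
  show ?thesis unfolding error_functional_def E c by (simp add: right_diff_distrib)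
qed

text \<open>The error depends only on the weights at 1, ..., N, so competitors such as midpoints can
  be compared with the minimum without an extensionality argument.\<close>

lemma min_err_le:
  assumes "(\<Sum>\<beta>=1..N. c \<beta>) = 1"
  shows "min_err m N x \<le> err_norm m N x c"
proof -
  have "error_norm m N x (restrict c {1..N}) = error_norm m N x c"
    by (simp add: error_norm_def error_functional_def)
  moreover have "restrict c {1..N} \<in> admissible_coeffs N"
    using assms by (simp add: admissible_coeffs_def)
  ultimately show ?thesis
    unfolding min_err_def err_norm_def by (metis (no_types, lifting) bdd_belowI2 cINF_lower enn2real_nonneg)
qed

lemma admissible_coeffs_nonempty: "admissible_coeffs N \<noteq> {}"
proof -
  have "(\<lambda>\<beta>\<in>{1..N}. 1 / real N) \<in> admissible_coeffs N" using N by (simp add: admissible_coeffs_def)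
  thus ?thesis by blast
qed

lemma min_err_nonneg: "0 \<le> min_err m N x"
  unfolding min_err_def using admissible_coeffs_nonempty err_norm_nonneg by (intro cINF_greatest)

text \<open>A quantitative strict convexity. The midpoint of two admissible vectors is admissible,
  so its norm is at least the minimum; the parallelogram inequality then leaves only the excesses of
  c and c' to bound the difference of their functionals. Testing that difference on the normalised
  \<open>node_fun\<close> yields the coefficient gap. K does not depend on x, nor on the
  vectors.\<close>

lemma coeff_diff_le:
  assumes \<beta>: "\<beta> \<in> {1..N}"
  obtains K where "0 < K"
    "\<And>x c c'. c \<in> admissible_coeffs N \<Longrightarrow> c' \<in> admissible_coeffs N \<Longrightarrow> K * (c \<beta> - c' \<beta>)\<^sup>2 \<le>
      2 * ((err_norm m N x c)\<^sup>2 - (min_err m N x)\<^sup>2) + 2 * ((err_norm m N x c')\<^sup>2 - (min_err m N x)\<^sup>2)"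
proof
  define \<kappa> where "\<kappa> = sobolev_norm m (node_fun N \<beta>)"
  have \<kappa>: "\<kappa> > 0" unfolding \<kappa>_def by (rule node_fun_norm_pos[OF \<beta>])
  show "0 < (real N / \<kappa>)\<^sup>2" using \<kappa> N by simp
  fix x and c c' :: "nat \<Rightarrow> real"
  assume "c \<in> admissible_coeffs N" "c' \<in> admissible_coeffs N"
  hence c: "(\<Sum>\<beta>=1..N. c \<beta>) = 1" "(\<Sum>\<beta>=1..N. c' \<beta>) = 1" by (auto simp: admissible_coeffs_def)
  define v where "v = (\<lambda>x. (1 / \<kappa>) * node_fun N \<beta> x)"
  have v: "v \<in> periodic_sobolev m" "sobolev_norm m v = 1"
    using periodic_sobolev_scale[OF m node_fun_in_periodic_sobolev[OF m], of "1 / \<kappa>" N \<beta>] \<kappa>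
    by (auto simp: v_def \<kappa>_def)
  have ev: "error_functional N x d v = error_functional N x d (node_fun N \<beta>) / \<kappa>" for d
    using error_functional_linear[of N x d "1 / \<kappa>" "node_fun N \<beta>" 0 v] by (simp add: v_def)
  have vdiff: "(error_functional N x c v - error_functional N x c' v)\<^sup>2 = (real N / \<kappa>)\<^sup>2 * (c \<beta> - c' \<beta>)\<^sup>2"
    unfolding ev diff_divide_distrib[symmetric] error_functional_node_fun_diff[OF c \<beta>]
    by (simp add: power_mult_distrib power_divide power2_commute)
  \<comment> \<open>With v fixed as the normalised \<open>node_fun\<close>, R is what the
    parallelogram inequality leaves for the square of the summed functionals, that is, of twice the
    midpoint functional, at any unit u.\<close>
  define R where "R = 2 * (err_norm m N x c)\<^sup>2 + 2 * (err_norm m N x c')\<^sup>2 - (real N / \<kappa>)\<^sup>2 * (c \<beta> - c' \<beta>)\<^sup>2"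
  define d where "d = (\<lambda>\<beta>. (c \<beta> + c' \<beta>) / 2)"
  have d: "(\<Sum>\<beta>=1..N. d \<beta>) = 1"
    using c by (simp add: d_def sum.distrib flip: sum_divide_distrib)
  have R: "(2 * error_functional N x d u)\<^sup>2 \<le> R"
    if "u \<in> periodic_sobolev m" "sobolev_norm m u = 1" for u
  proof -
    have "2 * error_functional N x d u = error_functional N x c u + error_functional N x c' u"
      by (simp add: error_functional_def d_def add_divide_distrib distrib_right sum.distrib
          flip: sum_divide_distrib)
    thus ?thesis
      using error_functional_parallelogram[OF c that v, of x] by (simp add: R_def vdiff)
  qed
  have R0: "0 \<le> R" using R[OF v] zero_le_power2 order_trans by blast
  have "err_norm m N x d \<le> sqrt R / 2"
  proof (rule err_norm_least[OF _ d])
    fix u assume "u \<in> periodic_sobolev m" "sobolev_norm m u = 1"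
    from R[OF this] have "\<bar>2 * error_functional N x d u\<bar> \<le> sqrt R" by (simp add: real_le_rsqrt)
    thus "\<bar>error_functional N x d u\<bar> \<le> sqrt R / 2" by simp
  qed (use R0 in simp)
  with min_err_le[OF d, of x] have "2 * min_err m N x \<le> sqrt R" by simp
  hence "(2 * min_err m N x)\<^sup>2 \<le> (sqrt R)\<^sup>2" by (intro power_mono) (simp_all add: min_err_nonneg)
  hence "4 * (min_err m N x)\<^sup>2 \<le> R" using R0 by (simp add: power_mult_distrib)
  thus "(real N / \<kappa>)\<^sup>2 * (c \<beta> - c' \<beta>)\<^sup>2 \<le>
      2 * ((err_norm m N x c)\<^sup>2 - (min_err m N x)\<^sup>2) + 2 * ((err_norm m N x c')\<^sup>2 - (min_err m N x)\<^sup>2)"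
    by (simp add: R_def)
qed

section \<open>Existence and uniqueness of the minimiser\<close>

lemma minimizer_unique:
  assumes "c \<in> admissible_coeffs N" "err_norm m N x c = min_err m N x"
    and "c' \<in> admissible_coeffs N" "err_norm m N x c' = min_err m N x"
  shows "c = c'"
proof (rule extensionalityI)
  fix \<beta> assume \<beta>: "\<beta> \<in> {1..N}"
  obtain K where K0: "0 < K" and K: "\<And>x c c'. c \<in> admissible_coeffs N \<Longrightarrow> c' \<in> admissible_coeffs N \<Longrightarrow>
      K * (c \<beta> - c' \<beta>)\<^sup>2 \<le> 2 * ((err_norm m N x c)\<^sup>2 - (min_err m N x)\<^sup>2)
        + 2 * ((err_norm m N x c')\<^sup>2 - (min_err m N x)\<^sup>2)"
    using coeff_diff_le[OF \<beta>] by blast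
  have "K * (c \<beta> - c' \<beta>)\<^sup>2 \<le> 0" using K[OF assms(1,3), of x] by (simp add: assms(2,4))
  thus "c \<beta> = c' \<beta>" using K0 by (simp add: mult_le_0_iff)
qed (use assms in \<open>auto simp: admissible_coeffs_def\<close>)

text \<open>A minimising sequence converges in each coefficient because its excesses tend to 0. For
  a fixed function the error is continuous in the finitely many weights, so the bound by the norm
  passes to the limit.\<close>

lemma minimizer_exists:
  obtains c where "c \<in> admissible_coeffs N" "err_norm m N x c = min_err m N x"
proof -
  have bdd: "bdd_below (err_norm m N x ` admissible_coeffs N)"
    by (intro bdd_belowI2[of _ 0] err_norm_nonneg)
  have "\<exists>c \<in> admissible_coeffs N. err_norm m N x c < min_err m N x + 1 / real (Suc n)" for n
    using cINF_less_iff[OF admissible_coeffs_nonempty bdd, of "min_err m N x + 1 / real (Suc n)"]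
    by (simp add: min_err_def)
  then obtain s where s: "\<And>n. s n \<in> admissible_coeffs N"
    and s_less: "\<And>n. err_norm m N x (s n) < min_err m N x + 1 / real (Suc n)" by metis
  have s_sum: "(\<Sum>\<beta>=1..N. s n \<beta>) = 1" for n using s by (auto simp: admissible_coeffs_def)
  have lim0: "(\<lambda>n. 1 / real (Suc n)) \<longlonglongrightarrow> 0" by (rule LIMSEQ_Suc[OF lim_1_over_n])
  have s_lim: "(\<lambda>n. err_norm m N x (s n)) \<longlonglongrightarrow> min_err m N x"
  proof (rule tendsto_sandwich)
    show "\<forall>\<^sub>F n in sequentially. min_err m N x \<le> err_norm m N x (s n)"
      using min_err_le[OF s_sum] by simp
    show "\<forall>\<^sub>F n in sequentially. err_norm m N x (s n) \<le> min_err m N x + 1 / real (Suc n)"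
      using s_less by (intro always_eventually allI less_imp_le)
    show "(\<lambda>n. min_err m N x + 1 / real (Suc n)) \<longlonglongrightarrow> min_err m N x"
      using tendsto_add[OF tendsto_const[of "min_err m N x"] lim0] by simp
  qed (rule tendsto_const)
  define e where "e n = (err_norm m N x (s n))\<^sup>2 - (min_err m N x)\<^sup>2" for n
  have e: "e \<longlonglongrightarrow> 0"
    unfolding e_def
    using tendsto_diff[OF tendsto_power[OF s_lim, of 2] tendsto_const[of "(min_err m N x)\<^sup>2"]] by simp
  have conv: "convergent (\<lambda>n. s n \<beta>)" if "\<beta> \<in> {1..N}" for \<beta>
  proof -
    obtain K where K0: "0 < K" and K: "\<And>x c c'. c \<in> admissible_coeffs N \<Longrightarrow> c' \<in> admissible_coeffs N \<Longrightarrow>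
      K * (c \<beta> - c' \<beta>)\<^sup>2 \<le> 2 * ((err_norm m N x c)\<^sup>2 - (min_err m N x)\<^sup>2)
        + 2 * ((err_norm m N x c')\<^sup>2 - (min_err m N x)\<^sup>2)"
      using coeff_diff_le[OF \<open>\<beta> \<in> {1..N}\<close>] by blast
    have "Cauchy (\<lambda>n. s n \<beta>)"
    proof (rule CauchyI)
      fix r :: real assume r: "0 < r"
      \<comment> \<open>\<open>coeff_diff_le\<close> doubles each of the two excesses, so keeping
        each below K r^2 / 4 gives a total below K r^2.\<close>
      have "0 < K * r\<^sup>2 / 4" using K0 r by simp
      from LIMSEQ_D[OF e this] obtain n0 where n0: "\<And>n. n \<ge> n0 \<Longrightarrow> \<bar>e n\<bar> < K * r\<^sup>2 / 4"
        by auto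
      have "norm (s i \<beta> - s j \<beta>) < r" if "i \<ge> n0" "j \<ge> n0" for i j
      proof -
        have "K * (s i \<beta> - s j \<beta>)\<^sup>2 \<le> 2 * e i + 2 * e j" unfolding e_def by (rule K[OF s s])
        also have "\<dots> < K * r\<^sup>2" using n0[OF that(1)] n0[OF that(2)] by simp
        finally have "\<bar>s i \<beta> - s j \<beta>\<bar>\<^sup>2 < r\<^sup>2" using K0 by simp
        from power_less_imp_less_base[OF this] r show ?thesis by simp
      qed
      thus "\<exists>M. \<forall>i\<ge>M. \<forall>j\<ge>M. norm (s i \<beta> - s j \<beta>) < r" by blast
    qed
    thus ?thesis by (simp add: Cauchy_convergent_iff)
  qed
  define c where "c = (\<lambda>\<beta>\<in>{1..N}. lim (\<lambda>n. s n \<beta>))"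
  have c_lim: "(\<lambda>n. s n \<beta>) \<longlonglongrightarrow> c \<beta>" if "\<beta> \<in> {1..N}" for \<beta>
    using conv[OF that] that by (simp add: c_def convergent_LIMSEQ_iff)
  have "(\<lambda>n. \<Sum>\<beta>=1..N. s n \<beta>) \<longlonglongrightarrow> (\<Sum>\<beta>=1..N. c \<beta>)" by (intro tendsto_sum c_lim)
  hence c_sum: "(\<Sum>\<beta>=1..N. c \<beta>) = 1" unfolding s_sum using LIMSEQ_unique tendsto_const by blast
  have "c \<in> admissible_coeffs N" using c_sum by (simp add: admissible_coeffs_def c_def)
  moreover have "err_norm m N x c \<le> min_err m N x"
  proof (rule err_norm_least[OF min_err_nonneg c_sum])
    fix \<phi> assume \<phi>: "\<phi> \<in> periodic_sobolev m" "sobolev_norm m \<phi> = 1"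
    show "\<bar>error_functional N x c \<phi>\<bar> \<le> min_err m N x"
    proof (rule LIMSEQ_le[OF _ s_lim])
      show "(\<lambda>n. \<bar>error_functional N x (s n) \<phi>\<bar>) \<longlonglongrightarrow> \<bar>error_functional N x c \<phi>\<bar>"
        unfolding error_functional_def by (intro tendsto_intros c_lim)
      show "\<exists>k. \<forall>n\<ge>k. \<bar>error_functional N x (s n) \<phi>\<bar> \<le> err_norm m N x (s n)"
        using error_functional_le_err_norm[OF s_sum \<phi>(1), of x] \<phi>(2) by auto
    qed
  qed
  ultimately show ?thesis using min_err_le[OF c_sum, of x] that by (simp add: antisym)
qed

text \<open>\<open>opt_coeff\<close> is a definite description of an \<open>ennreal\<close>
  minimiser, while existence and uniqueness concern the real infimum \<open>min_err\<close>;
  finiteness of the norm makes the two notions agree on admissible vectors. Later this recognises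
  shifted coefficients as optimal.\<close>

lemma opt_coeff_eqI:
  assumes c: "c \<in> admissible_coeffs N" and "err_norm m N x c = min_err m N x"
  shows "opt_coeff m N \<beta> x = c \<beta>"
proof -
  have iff: "(c' \<in> admissible_coeffs N \<and> (\<forall>c'' \<in> admissible_coeffs N. error_norm m N x c' \<le> error_norm m N x c''))
    \<longleftrightarrow> (c' \<in> admissible_coeffs N \<and> err_norm m N x c' = min_err m N x)" for c'
  proof (cases "c' \<in> admissible_coeffs N")
    case True
    have "(\<forall>c'' \<in> admissible_coeffs N. error_norm m N x c' \<le> error_norm m N x c'') \<longleftrightarrow>
       (\<forall>c'' \<in> admissible_coeffs N. err_norm m N x c' \<le> err_norm m N x c'')"
      using True by (intro ball_cong refl)
        (simp add: admissible_coeffs_def error_norm_eq ennreal_le_iff err_norm_nonneg)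
    also have "\<dots> \<longleftrightarrow> err_norm m N x c' = min_err m N x"
    proof
      assume "\<forall>c'' \<in> admissible_coeffs N. err_norm m N x c' \<le> err_norm m N x c''"
      hence "err_norm m N x c' \<le> min_err m N x"
        unfolding min_err_def using admissible_coeffs_nonempty by (intro cINF_greatest) auto
      with min_err_le[of c' x] True show "err_norm m N x c' = min_err m N x"
        by (simp add: admissible_coeffs_def)
    next
      assume "err_norm m N x c' = min_err m N x"
      thus "\<forall>c'' \<in> admissible_coeffs N. err_norm m N x c' \<le> err_norm m N x c''"
        using min_err_le by (simp add: admissible_coeffs_def)
    qed
    finally show ?thesis by simp
  qed simp
  have "(THE c'. c' \<in> admissible_coeffs N \<and> err_norm m N x c' = min_err m N x) = c"
    using assms by (intro the_equality) (auto intro: minimizer_unique)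
  thus ?thesis unfolding opt_coeff_def iff by simp
qed

lemma opt_coeff_minimizer:
  "(\<lambda>\<beta>. opt_coeff m N \<beta> x) \<in> admissible_coeffs N"
  "err_norm m N x (\<lambda>\<beta>. opt_coeff m N \<beta> x) = min_err m N x"
proof -
  obtain c where c: "c \<in> admissible_coeffs N" "err_norm m N x c = min_err m N x"
    by (rule minimizer_exists)
  hence "(\<lambda>\<beta>. opt_coeff m N \<beta> x) = c" using opt_coeff_eqI by blast
  with c show "(\<lambda>\<beta>. opt_coeff m N \<beta> x) \<in> admissible_coeffs N"
    "err_norm m N x (\<lambda>\<beta>. opt_coeff m N \<beta> x) = min_err m N x" by simp_all
qed

lemma sum_opt_coeff: "(\<Sum>\<beta>=1..N. opt_coeff m N \<beta> x) = 1"
  using opt_coeff_minimizer(1)[of x] by (simp add: admissible_coeffs_def)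

section \<open>Continuity of the optimal coefficients in the point\<close>

lemma err_norm_modulus:
  assumes c: "(\<Sum>\<beta>=1..N. c \<beta>) = 1" and xy: "\<bar>x - y\<bar> \<le> 1"
  shows "err_norm m N x c \<le> err_norm m N y c + sqrt \<bar>x - y\<bar>"
proof (rule err_norm_least[OF _ c])
  fix \<phi> assume \<phi>: "\<phi> \<in> periodic_sobolev m" "sobolev_norm m \<phi> = 1"
  have "error_functional N x c \<phi> = error_functional N y c \<phi> + (\<phi> x - \<phi> y)"
    by (simp add: error_functional_def)
  thus "\<bar>error_functional N x c \<phi>\<bar> \<le> err_norm m N y c + sqrt \<bar>x - y\<bar>"
    using error_functional_le_err_norm[OF c \<phi>(1), of y] periodic_sobolev_modulus[OF m \<phi>(1) xy] \<phi>(2)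
    by simp
qed (simp add: err_norm_nonneg)

lemma min_err_modulus:
  assumes xy: "\<bar>x - y\<bar> \<le> 1"
  shows "min_err m N x \<le> min_err m N y + sqrt \<bar>x - y\<bar>"
  using min_err_le[OF sum_opt_coeff, of x y] err_norm_modulus[OF sum_opt_coeff xy, of y]
    opt_coeff_minimizer(2)[of y] by simp

lemma isCont_opt_coeff:
  assumes \<beta>: "\<beta> \<in> {1..N}"
  shows "isCont (opt_coeff m N \<beta>) x"
proof -
  obtain K where K0: "0 < K" and K: "\<And>x c c'. c \<in> admissible_coeffs N \<Longrightarrow> c' \<in> admissible_coeffs N \<Longrightarrow>
      K * (c \<beta> - c' \<beta>)\<^sup>2 \<le> 2 * ((err_norm m N x c)\<^sup>2 - (min_err m N x)\<^sup>2)
        + 2 * ((err_norm m N x c')\<^sup>2 - (min_err m N x)\<^sup>2)"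
    using coeff_diff_le[OF \<beta>] by blast
  define D where "D = min_err m N x"
  \<comment> \<open>The minimiser for y, used at x, has error at most D + 2 sqrt |y - x|: one square
    root for moving the functional from y to x, one for comparing the two minima. Its excess,
    doubled and divided by K, is at most r y; the minimiser at x has excess 0.\<close>
  define r where "r y = 2 * ((D + 2 * sqrt \<bar>y - x\<bar>)\<^sup>2 - D\<^sup>2) / K" for y
  have "\<bar>opt_coeff m N \<beta> y - opt_coeff m N \<beta> x\<bar> \<le> sqrt (r y)" if "\<bar>y - x\<bar> \<le> 1" for y
  proof -
    have "err_norm m N x (\<lambda>\<beta>. opt_coeff m N \<beta> y) \<le> D + 2 * sqrt \<bar>y - x\<bar>"
      using err_norm_modulus[OF sum_opt_coeff, of x y y] min_err_modulus[of y x] that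
        opt_coeff_minimizer(2)[of y] by (simp add: D_def abs_minus_commute)
    hence "(err_norm m N x (\<lambda>\<beta>. opt_coeff m N \<beta> y))\<^sup>2 \<le> (D + 2 * sqrt \<bar>y - x\<bar>)\<^sup>2"
      by (intro power_mono err_norm_nonneg)
    with K[OF opt_coeff_minimizer(1)[of y] opt_coeff_minimizer(1)[of x], of x]
    have "K * (opt_coeff m N \<beta> y - opt_coeff m N \<beta> x)\<^sup>2 \<le> 2 * ((D + 2 * sqrt \<bar>y - x\<bar>)\<^sup>2 - D\<^sup>2)"
      by (simp add: opt_coeff_minimizer(2) D_def)
    hence "(opt_coeff m N \<beta> y - opt_coeff m N \<beta> x)\<^sup>2 \<le> r y"
      using K0 by (simp add: r_def field_simps)
    thus ?thesis by (simp add: real_le_rsqrt)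
  qed
  moreover have "\<forall>\<^sub>F y in at x. \<bar>y - x\<bar> \<le> 1"
    unfolding eventually_at by (rule exI[of _ 1]) (simp add: dist_real_def)
  ultimately have ev: "\<forall>\<^sub>F y in at x. \<bar>opt_coeff m N \<beta> y - opt_coeff m N \<beta> x\<bar> \<le> sqrt (r y)"
    by (auto elim: eventually_mono)
  have "isCont (\<lambda>y. sqrt (r y)) x" unfolding r_def using K0 by (intro continuous_intros) auto
  hence lim: "((\<lambda>y. sqrt (r y)) \<longlongrightarrow> 0) (at x)" by (simp add: isCont_def r_def)
  have "((\<lambda>y. opt_coeff m N \<beta> y - opt_coeff m N \<beta> x) \<longlongrightarrow> 0) (at x)"
    by (rule Lim_null_comparison[OF _ lim]) (use ev in simp)
  thus ?thesis unfolding isCont_def by (simp add: LIM_zero_iff)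
qed

section \<open>Invariance under a full period and under one node step\<close>

lemma error_norm_periodic: "error_norm m N (x + 1) c = error_norm m N x c"
  unfolding error_norm_def error_functional_def
  by (intro SUP_cong refl) (simp add: periodic_sobolevD(1)[of _ m])

lemma opt_coeff_periodic: "opt_coeff m N \<beta> (x + 1) = opt_coeff m N \<beta> x"
  by (simp add: opt_coeff_def error_norm_periodic)

lemma err_norm_cyclic_shift:
  assumes c: "c \<in> admissible_coeffs N"
  shows "err_norm m N (x + 1 / real N) (cyclic_shift N c) \<le> err_norm m N x c"
proof (rule err_norm_least[OF err_norm_nonneg])
  have N0: "0 < N" using N by simp
  show "(\<Sum>\<beta>=1..N. cyclic_shift N c \<beta>) = 1"
    using cyclic_shift_admissible[OF N0 c] by (simp add: admissible_coeffs_def)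
  have c': "(\<Sum>\<beta>=1..N. c \<beta>) = 1" using c by (simp add: admissible_coeffs_def)
  fix \<phi> assume \<phi>: "\<phi> \<in> periodic_sobolev m" "sobolev_norm m \<phi> = 1"
  have "0 \<le> 1 / real N" "1 / real N \<le> 1" using N by auto
  note S = periodic_sobolev_shift[OF m \<phi>(1) this]
  show "\<bar>error_functional N (x + 1 / real N) (cyclic_shift N c) \<phi>\<bar> \<le> err_norm m N x c"
    unfolding error_functional_cyclic_shift[of N \<phi>, OF N0 periodic_sobolevD(1)[OF \<phi>(1)]]
    using error_functional_le_err_norm[OF c' S(1), of x] S(2) \<phi>(2) by simp
qed

text \<open>
  The shift by one node only gives an inequality between the minimal errors, but after \<open>N\<close>
  shifts it returns to the start.
\<close>

lemma min_err_shift: "min_err m N (x + 1 / real N) = min_err m N x"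
proof -
  have *: "min_err m N (y + 1 / real N) \<le> min_err m N y" for y
  proof -
    have "0 < N" using N by simp
    hence "cyclic_shift N (\<lambda>\<beta>. opt_coeff m N \<beta> y) \<in> admissible_coeffs N"
      by (intro cyclic_shift_admissible opt_coeff_minimizer)
    thus ?thesis
      using err_norm_cyclic_shift[OF opt_coeff_minimizer(1)[of y], of y] opt_coeff_minimizer(2)[of y]
        min_err_le[of "cyclic_shift N (\<lambda>\<beta>. opt_coeff m N \<beta> y)" "y + 1 / real N"]
      by (simp add: admissible_coeffs_def)
  qed
  have "min_err m N (x + 1 / real N + real k * (1 / real N)) \<le> min_err m N (x + 1 / real N)" for k
  proof (induction k)
    case (Suc k)
    thus ?case using *[of "x + 1 / real N + real k * (1 / real N)"]
      by (simp add: add_divide_distrib algebra_simps)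
  qed simp
  from this[of "N - 1"] have "min_err m N (x + 1) \<le> min_err m N (x + 1 / real N)"
    using N by (simp add: of_nat_diff diff_divide_distrib)
  thus ?thesis using *[of x] by (simp add: min_err_def err_norm_def error_norm_periodic)
qed

text \<open>The shifted minimiser attains the equal minimum at x + h, so uniqueness identifies it
  with the minimiser there. Indices below N suffice, since the chain from 1 to N already links all
  coefficients.\<close>

lemma opt_coeff_shift:
  assumes "\<beta> \<in> {1..<N}"
  shows "opt_coeff m N (\<beta> + 1) (x + 1 / real N) = opt_coeff m N \<beta> x"
proof -
  define c where "c = cyclic_shift N (\<lambda>\<beta>. opt_coeff m N \<beta> x)"
  have "0 < N" using N by simp
  hence c: "c \<in> admissible_coeffs N"
    unfolding c_def by (intro cyclic_shift_admissible opt_coeff_minimizer)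
  have "err_norm m N (x + 1 / real N) c = min_err m N (x + 1 / real N)"
    using err_norm_cyclic_shift[OF opt_coeff_minimizer(1)[of x], of x] opt_coeff_minimizer(2)[of x]
      min_err_le[of c "x + 1 / real N"] c
    by (simp add: c_def min_err_shift admissible_coeffs_def)
  from opt_coeff_eqI[OF c this] show ?thesis using assms by (simp add: c_def cyclic_shift_def)
qed

section \<open>Integrals of the coefficients over a period\<close>

lemma set_integrable_opt_coeff:
  "\<beta> \<in> {1..N} \<Longrightarrow> set_integrable lborel {a..b} (opt_coeff m N \<beta>)"
  by (intro borel_integrable_atLeastAtMost' continuous_at_imp_continuous_on ballI isCont_opt_coeff)

lemma integral_opt_coeff_Suc:
  assumes \<beta>: "\<beta> \<in> {1..<N}"
  shows "(LBINT x:{0..1}. opt_coeff m N (\<beta> + 1) x) = (LBINT x:{0..1}. opt_coeff m N \<beta> x)"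
proof -
  define h where "h = 1 / real N"
  have \<beta>': "\<beta> + 1 \<in> {1..N}" using \<beta> by auto
  have h: "0 \<le> h" "h \<le> 1" using N by (auto simp: h_def)
  have "(LBINT x:{0..1}. opt_coeff m N (\<beta> + 1) x) = (LBINT x:{h..h + 1}. opt_coeff m N (\<beta> + 1) x)"
  proof (rule set_integral_periodic(2)[symmetric])
    have "continuous_on UNIV (opt_coeff m N (\<beta> + 1))"
      using isCont_opt_coeff[OF \<beta>'] by (simp add: continuous_at_imp_continuous_on)
    thus "opt_coeff m N (\<beta> + 1) \<in> borel_measurable lborel"
      by (simp add: borel_measurable_continuous_onI)
  qed (use h opt_coeff_periodic set_integrable_opt_coeff[OF \<beta>'] in auto)
  also have "\<dots> = (LBINT x:{0..1}. opt_coeff m N (\<beta> + 1) (x + h))"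
    using set_integrable_shift(2)[of 0 h 1 "opt_coeff m N (\<beta> + 1)"] set_integrable_opt_coeff[OF \<beta>']
    by (simp add: add.commute)
  also have "\<dots> = (LBINT x:{0..1}. opt_coeff m N \<beta> x)"
    unfolding h_def using opt_coeff_shift[OF \<beta>] by simp
  finally show ?thesis .
qed

text \<open>The weights w are left free for two uses: w = 1 turns the sum condition into a value for
  the common integral, and the nodal values of phi give the quadrature formula.\<close>

lemma set_integral_sum_opt_coeff:
  "(LBINT x:{0..1}. (\<Sum>\<beta>=1..N. opt_coeff m N \<beta> x * w \<beta>))
    = (\<Sum>\<beta>=1..N. (LBINT x:{0..1}. opt_coeff m N \<beta> x) * w \<beta>)"
  "set_integrable lborel {0..1} (\<lambda>x. \<Sum>\<beta>=1..N. opt_coeff m N \<beta> x * w \<beta>)"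
proof -
  have int: "integrable lborel (\<lambda>x. indicator {0..1} x *\<^sub>R (opt_coeff m N \<beta> x * w \<beta>))"
    if "\<beta> \<in> {1..N}" for \<beta>
    using set_integrable_mult_left[OF set_integrable_opt_coeff[OF that]] unfolding set_integrable_def by blast
  thus "set_integrable lborel {0..1} (\<lambda>x. \<Sum>\<beta>=1..N. opt_coeff m N \<beta> x * w \<beta>)"
    unfolding set_integrable_def scaleR_sum_right by (intro Bochner_Integration.integrable_sum)
  have "(LBINT x:{0..1}. (\<Sum>\<beta>=1..N. opt_coeff m N \<beta> x * w \<beta>))
    = (\<Sum>\<beta>=1..N. (LBINT x:{0..1}. opt_coeff m N \<beta> x * w \<beta>))"
    unfolding set_lebesgue_integral_def scaleR_sum_right
    by (intro Bochner_Integration.integral_sum int)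
  thus "(LBINT x:{0..1}. (\<Sum>\<beta>=1..N. opt_coeff m N \<beta> x * w \<beta>))
    = (\<Sum>\<beta>=1..N. (LBINT x:{0..1}. opt_coeff m N \<beta> x) * w \<beta>)" by simp
qed

lemma integral_opt_coeff:
  assumes "\<beta> \<in> {1..N}"
  shows "(LBINT x:{0..1}. opt_coeff m N \<beta> x) = 1 / real N"
proof -
  define I where "I = (LBINT x:{0..1}. opt_coeff m N 1 x)"
  have I: "(LBINT x:{0..1}. opt_coeff m N \<gamma> x) = I" if "1 \<le> \<gamma>" "\<gamma> \<le> N" for \<gamma>
    using that
  proof (induction \<gamma> rule: dec_induct)
    case (step n)
    thus ?case using integral_opt_coeff_Suc[of n] by simp
  qed (simp add: I_def)
  have "(LBINT x:{0..1}. (\<Sum>\<beta>=1..N. opt_coeff m N \<beta> x * 1)) = real N * I"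
    unfolding set_integral_sum_opt_coeff(1) using I by simp
  moreover have "(LBINT x:{0..1}. (\<Sum>\<beta>=1..N. opt_coeff m N \<beta> x * 1)) = 1"
    using sum_opt_coeff by (simp add: set_integral_const)
  ultimately show ?thesis using I assms N by (simp add: field_simps)
qed

end

theorem mainTheorem5:
  fixes m N :: nat and h :: real and \<phi> :: "real \<Rightarrow> real"
  assumes "m \<ge> 1" and "N \<ge> 2" and "h = 1 / real N"
    and "\<phi> \<in> periodic_sobolev m"
  shows "set_integrable lborel {0..1} (\<lambda>x. \<Sum>\<beta>=1..N. opt_coeff m N \<beta> x * \<phi> (h * real \<beta>)) \<and>
         (LBINT x:{0..1}. (\<Sum>\<beta>=1..N. opt_coeff m N \<beta> x * \<phi> (h * real \<beta>)))
           = h * (\<Sum>\<beta>=1..N. \<phi> (h * real \<beta>))"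
proof -
  have m: "0 < m" using assms(1) by simp
  note S = set_integral_sum_opt_coeff[OF m assms(2), of "\<lambda>\<beta>. \<phi> (h * real \<beta>)"]
  have "(\<Sum>\<beta>=1..N. (LBINT x:{0..1}. opt_coeff m N \<beta> x) * \<phi> (h * real \<beta>))
      = h * (\<Sum>\<beta>=1..N. \<phi> (h * real \<beta>))"
    unfolding sum_distrib_left
    by (intro sum.cong refl) (simp add: integral_opt_coeff[OF m assms(2)] assms(3))
  with S show ?thesis by simp
qed

end
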